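(* Let $K$ be a field of characteristic zero and let $w\in W=S_n$. Then $w$ is homogeneous if and only if $w=w_D$ for some basic subset $D\subset\Delta^+$.
   Context: Roots. Fix $n\ge 1$. A positive root is a pair $(i,j)$ with $n\ge i>j\ge 1$; $\Delta^+$ is the set of positive roots; $i$ is its row and $j$ its column. For positive roots, $\gamma=\alpha+\beta$ means $\gamma=(i,k)$ and $\{\alpha,\beta\}=\{(i,j),(j,k)\}$ for some $i>j>k$. A subset $D\subset\Delta^+$ is basic if every row and every column contains at most one root of $D$. A positive root $\alpha$ is $D$-singular if there is a positive root $\beta$ with $\alpha+\beta\in D$; $S(D)$ is the set of $D$-singular roots, $R(D)=\Delta^+\setminus S(D)$, and $M(D)=R(D)\setminus D$. The permutation $w_D$. $w_D\in S_n$ is defined recursively: for $j=1,\dots,n$, $w_D(j)$ is the greatest $i\in\{1,\dots,n\}$ such that $(i,j)\notin M(D)$ and $i\notin\{w_D(1),\dots,w_D(j-1)\}$. Schubert varieties. Let $G=\mathrm{GL}(n,K)$, $B$ the subgroup of upper triangular matrices, $N_-$ the group of lower unitriangular matrices, $\mathfrak n_-$ the space of strictly lower triangular matrices, $\mathcal X=G/B$ the flag variety, $p=B\bmod B$. The main affine neighborhood of $p$ is $\mathcal O=N_-B\bmod B$; the isomorphism of affine varieties $\Psi:\mathcal O\to\mathfrak n_-$ is defined by $g=(1+\Psi(g))\bmod B$ for $g\in\mathcal O$, and sends $p$ to $0$. For $w\in W=S_n$ let $\dot w$ be the permutation matrix with ones at the places $(w(j),j)$; the Schubert cell is $\mathcal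 X_w^\circ=B\dot wB\bmod B$ and the Schubert variety $\mathcal X_w$ is its Zariski closure. Put $\mathcal Y_w=\Psi(\mathcal X_w\cap\mathcal O)\subset\mathfrak n_-$. An element $w\in W$ is called homogeneous if, under the identification $\mathcal O\cong\mathfrak n_-$, $\mathcal Y_w$ is a cone with center at the point $p$ (the origin of $\mathfrak n_-$). *)

theory Defs
  imports
    "HOL-Combinatorics.Permutations"
    "HOL-Algebra.Coset"
    "Jordan_Normal_Form.Matrix"
begin

definition positive_roots :: "nat \<Rightarrow> (nat \<times> nat) set" where
  "positive_roots n = {(i, j). n \<ge> i \<and> i > j \<and> j \<ge> 1}"

definition root_sum :: "nat \<times> nat \<Rightarrow> nat \<times> nat \<Rightarrow> nat \<times> nat \<Rightarrow> bool" where
  "root_sum \<alpha> \<beta> \<gamma> \<longleftrightarrow>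
     (\<exists>i j k. i > j \<and> j > k \<and> \<gamma> = (i, k) \<and> {\<alpha>, \<beta>} = {(i, j), (j, k)})"

definition basic :: "nat \<Rightarrow> (nat \<times> nat) set \<Rightarrow> bool" where
  "basic n D \<longleftrightarrow> D \<subseteq> positive_roots n \<and> inj_on fst D \<and> inj_on snd D"

definition singular_roots :: "nat \<Rightarrow> (nat \<times> nat) set \<Rightarrow> (nat \<times> nat) set" where
  "singular_roots n D =
     {\<alpha> \<in> positive_roots n. \<exists>\<beta> \<in> positive_roots n. \<exists>\<gamma> \<in> D. root_sum \<alpha> \<beta> \<gamma>}"

definition regular_roots :: "nat \<Rightarrow> (nat \<times> nat) set \<Rightarrow> (nat \<times> nat) set" where
  "regular_roots n D = positive_roots n - singular_roots n D"

definition M_roots :: "nat \<Rightarrow> (nat \<times> nat) set \<Rightarrow> (nat \<times> nat) set" where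
  "M_roots n D = regular_roots n D - D"

text \<open>
  The permutation \<open>w\<^sub>D\<close>, extended by the identity outside \<open>{1..n}\<close> (the convention of
  \<open>permutes\<close>). The maximum is over a nonempty set: among the indices \<open>1, \<dots>, j\<close>, none of which
  is excluded by \<open>M_roots n D\<close>, at most \<open>j - 1\<close> have been used before.
\<close>
fun w_perm :: "nat \<Rightarrow> (nat \<times> nat) set \<Rightarrow> nat \<Rightarrow> nat" where
  "w_perm n D j =
     (if j \<in> {1..n}
      then Max {i \<in> {1..n}. (i, j) \<notin> M_roots n D \<and> i \<notin> w_perm n D ` {1..<j}}
      else j)"

declare w_perm.simps [simp del]

text \<open>
  Matrix entries are indexed from \<open>0\<close>, so the entry at the place \<open>(i, j)\<close> is
  \<open>A $$ (i - 1, j - 1)\<close>.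
\<close>

definition GL :: "nat \<Rightarrow> 'a::field mat monoid" where
  "GL n = units_of (ring_mat TYPE('a) n ())"

definition Borel :: "nat \<Rightarrow> 'a::field mat set" where
  "Borel n = {A \<in> carrier (GL n). upper_triangular A}"

definition strictly_lower :: "nat \<Rightarrow> 'a::field mat set" where
  "strictly_lower n =
     {A \<in> carrier_mat n n. \<forall>i<n. \<forall>j<n. i \<le> j \<longrightarrow> A $$ (i, j) = 0}"

definition lower_unitriangular :: "nat \<Rightarrow> 'a::field mat set" where
  "lower_unitriangular n =
     {A \<in> carrier_mat n n. (\<forall>i<n. A $$ (i, i) = 1) \<and> (\<forall>i<n. \<forall>j<n. i < j \<longrightarrow> A $$ (i, j) = 0)}"

abbreviation mod_Borel :: "nat \<Rightarrow> 'a::field mat \<Rightarrow> 'a mat set" where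
  "mod_Borel n g \<equiv> g <#\<^bsub>GL n\<^esub> Borel n"

definition flag_variety :: "nat \<Rightarrow> 'a::field mat set set" where
  "flag_variety n = mod_Borel n ` carrier (GL n)"

text \<open>Polynomial functions of the \<open>n\<^sup>2\<close> matrix entries.\<close>
inductive_set poly_funs :: "nat \<Rightarrow> ('a::field mat \<Rightarrow> 'a) set" for n :: nat where
  const: "(\<lambda>A. c) \<in> poly_funs n"
| entry: "i < n \<Longrightarrow> j < n \<Longrightarrow> (\<lambda>A. A $$ (i, j)) \<in> poly_funs n"
| add: "f \<in> poly_funs n \<Longrightarrow> g \<in> poly_funs n \<Longrightarrow> (\<lambda>A. f A + g A) \<in> poly_funs n"
| mult: "f \<in> poly_funs n \<Longrightarrow> g \<in> poly_funs n \<Longrightarrow> (\<lambda>A. f A * g A) \<in> poly_funs n"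

text \<open>
  The Zariski topology of \<open>G/B\<close> is the quotient of that of \<open>G\<close>: a set of flags is closed iff its
  preimage in \<open>G\<close> is the zero locus in \<open>G\<close> of a set of regular functions. Polynomials in the
  entries suffice, as powers of the invertible determinant can be cleared.
\<close>
definition zariski_closed :: "nat \<Rightarrow> 'a::field mat set set \<Rightarrow> bool" where
  "zariski_closed n F \<longleftrightarrow>
     F \<subseteq> flag_variety n \<and>
     (\<exists>P \<subseteq> poly_funs n.
        {g \<in> carrier (GL n). mod_Borel n g \<in> F} = {g \<in> carrier (GL n). \<forall>f\<in>P. f g = 0})"

definition perm_matrix :: "nat \<Rightarrow> (nat \<Rightarrow> nat) \<Rightarrow> 'a::field mat" where
  "perm_matrix n w = mat n n (\<lambda>(i, j). if w (j + 1) = i + 1 then 1 else 0)"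

definition schubert_cell :: "nat \<Rightarrow> (nat \<Rightarrow> nat) \<Rightarrow> 'a::field mat set set" where
  "schubert_cell n w = (\<lambda>b. mod_Borel n (b * perm_matrix n w)) ` Borel n"

definition schubert_variety :: "nat \<Rightarrow> (nat \<Rightarrow> nat) \<Rightarrow> 'a::field mat set set" where
  "schubert_variety n w = zariski_closed n hull schubert_cell n w"

definition main_nbhd :: "nat \<Rightarrow> 'a::field mat set set" where
  "main_nbhd n = mod_Borel n ` lower_unitriangular n"

text \<open>Well defined on \<open>main_nbhd n\<close>, since \<open>lower_unitriangular n \<inter> Borel n = {1\<^sub>m n}\<close>.\<close>
definition Psi :: "nat \<Rightarrow> 'a::field mat set \<Rightarrow> 'a mat" where
  "Psi n g = (THE x. x \<in> strictly_lower n \<and> g = mod_Borel n (1\<^sub>m n + x))"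

definition Y_set :: "nat \<Rightarrow> (nat \<Rightarrow> nat) \<Rightarrow> 'a::field mat set" where
  "Y_set n w = Psi n ` (schubert_variety n w \<inter> main_nbhd n)"

definition is_cone :: "'a::field mat set \<Rightarrow> bool" where
  "is_cone Y \<longleftrightarrow> (\<forall>x\<in>Y. \<forall>t. t \<cdot>\<^sub>m x \<in> Y)"

definition homogeneous :: "'a::field itself \<Rightarrow> nat \<Rightarrow> (nat \<Rightarrow> nat) \<Rightarrow> bool" where
  "homogeneous K n w \<longleftrightarrow> is_cone (Y_set n w :: 'a mat set)"

end

theory Submission
  imports Defs "Jordan_Normal_Form.Determinant"
begin

text \<open>
  The group \<open>B\<close> of upper triangular matrices adds lower rows to upper rows (acting on the left) and
  left columns to right columns (acting on the right), so the double coset of an invertible matrix is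
  determined by the ranks of its south-west corner submatrices, and \<open>g B\<close> lies in the Schubert variety
  of \<open>w\<close> iff every such corner of \<open>g\<close> has at most the rank of the same corner of the permutation
  matrix of \<open>w\<close> (\<open>schubert_variety_iff_sw_factors\<close>). This rests on the Bruhat decomposition, on
  the chain property of the Bruhat order, and on two facts about closures: the vanishing of a minor of a
  corner, together with all its translates by \<open>B\<close>, is a closed condition, and a line of matrices degenerates the cell of \<open>v \<circ> (j k)\<close> to the
  cell of \<open>v\<close> whenever \<open>v j < v k\<close>.

  In \<open>1 + x\<close> with \<open>x\<close> strictly lower triangular, a corner that avoids the diagonal is a corner of \<open>x\<close>,
  and its rank does not increase when \<open>x\<close> is scaled. Whether \<open>Y_set n w\<close> is a cone is therefore
  decided by the corners that meet the diagonal. The relevant ones sit at the boxes of the Rothe diagram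
  of \<open>w\<close> on or above the diagonal, called \<open>upper_diagram_box\<close> below.

  \<^item> If \<open>w\<close> has no such box, then the conditions on the corners below the diagonal imply all the others
    (\<open>sw_rank_le_if_le_below_diagonal\<close>), and \<open>Y_set n w\<close> is a cone.

  \<^item> If \<open>w\<close> has such a box, let \<open>r\<close> be the rank of its corner. A suitable \<open>1 + x\<close> satisfies all the
    rank conditions, but for generic \<open>t\<close> the corner of \<open>1 + t x\<close> at this box has rank greater than
    \<open>r\<close>. To find \<open>x\<close>, note that to first order the determinant of an \<open>(r + 1) \<times> (r + 1)\<close> matrix \<open>H\<close> of rank \<open>r\<close>
    with left and right null vectors \<open>\<rho>\<close> and \<open>\<kappa>\<close> moves off zero in direction \<open>E\<close> iff \<open>\<rho> E \<kappa> \<noteq> 0\<close>.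
    Here \<open>E\<close> is the corner of the identity matrix, and \<open>\<rho> E \<kappa>\<close> is a sum of products of entries of the
    inverse of \<open>1 + x\<close>. Take \<open>1 + x\<close> to be a product of bidiagonal matrices with nonnegative entries:
    such a matrix is totally nonnegative, so the signs of the entries of its inverse alternate, all the
    products have the same sign, and the sum does not vanish (\<open>bidiag_inv_mat_square_corner\<close>). The
    order of the factors is chosen so that the product and its inverse are band matrices of the widths
    that the rank conditions require.

  Finally, for a basic set \<open>D\<close> the recursion for \<open>w_perm n D\<close> takes the value \<open>i\<close> at \<open>j\<close> if \<open>(i, j) \<in> D\<close>, and otherwise the greatest
  unused value that is at most \<open>j\<close>. So \<open>w\<close> is of this form, with \<open>D\<close> the set of its excedances, iff it has no
  box on or above the diagonal (\<open>w_perm_eq_iff_no_upper_diagram_box\<close>).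
\<close>

section \<open>Ranks of south-west corners of permutation matrices\<close>

text \<open>
  The rank of the corner of \<open>perm_matrix n w\<close> formed by the rows from \<open>i\<close> on and the first \<open>l\<close> columns.
  Rows are counted from \<open>0\<close>, as matrix indices are, whereas \<open>w\<close> permutes \<open>{1..n}\<close>; so the corner
  lies strictly below the diagonal iff \<open>l \<le> i\<close>.
\<close>
definition sw_rank :: "(nat \<Rightarrow> nat) \<Rightarrow> nat \<Rightarrow> nat \<Rightarrow> nat" where
  "sw_rank w i l = card {a \<in> {1..l}. i < w a}"

lemma sw_rank_0_col [simp]: "sw_rank w i 0 = 0"
  by (simp add: sw_rank_def)

lemma sw_rank_Suc_col:
  "sw_rank w i (Suc l) = sw_rank w i l + (if i < w (Suc l) then 1 else 0)"
proof -
  have "{a \<in> {1..Suc l}. i < w a} =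
      (if i < w (Suc l) then insert (Suc l) {a \<in> {1..l}. i < w a} else {a \<in> {1..l}. i < w a})"
    by (auto simp: le_Suc_eq)
  then show ?thesis by (simp add: sw_rank_def)
qed

lemma sw_rank_split_row:
  assumes "i \<le> i'"
  shows "sw_rank w i l = sw_rank w i' l + card {a \<in> {1..l}. i < w a \<and> w a \<le> i'}"
proof -
  have "{a \<in> {1..l}. i < w a} = {a \<in> {1..l}. i' < w a} \<union> {a \<in> {1..l}. i < w a \<and> w a \<le> i'}"
    using assms by auto
  moreover have "card ({a \<in> {1..l}. i' < w a} \<union> {a \<in> {1..l}. i < w a \<and> w a \<le> i'}) =
      card {a \<in> {1..l}. i' < w a} + card {a \<in> {1..l}. i < w a \<and> w a \<le> i'}"
    by (rule card_Un_disjoint) auto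
  ultimately show ?thesis by (simp add: sw_rank_def)
qed

lemma sw_rank_Suc_row:
  assumes "inj w"
  shows "sw_rank w i l = sw_rank w (Suc i) l + (if \<exists>a\<in>{1..l}. w a = Suc i then 1 else 0)"
proof -
  have "{a \<in> {1..l}. i < w a \<and> w a \<le> Suc i} = {a \<in> {1..l}. w a = Suc i}"
    by auto
  moreover have "card {a \<in> {1..l}. w a = Suc i} = (if \<exists>a\<in>{1..l}. w a = Suc i then 1 else 0)"
  proof (cases "\<exists>a\<in>{1..l}. w a = Suc i")
    case True
    then obtain a where "a \<in> {1..l}" "w a = Suc i" by blast
    then have "{a \<in> {1..l}. w a = Suc i} = {a}"
      using injD[OF assms] by auto
    then show ?thesis using True by simp
  next
    case False
    then have "{a \<in> {1..l}. w a = Suc i} = {}" by blast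
    then show ?thesis using False by simp
  qed
  ultimately show ?thesis
    using sw_rank_split_row[of i "Suc i" w l] by simp
qed

lemma sw_rank_mono:
  assumes "i \<le> i'" "l' \<le> l"
  shows "sw_rank w i' l' \<le> sw_rank w i l"
  unfolding sw_rank_def using assms by (intro card_mono) auto

lemma sw_rank_row_diff:
  assumes "inj w"
  shows "sw_rank w i l - a \<le> sw_rank w (i + a) l"
proof (induction a)
  case (Suc a)
  have "sw_rank w (i + a) l \<le> sw_rank w (i + Suc a) l + 1"
    by (subst sw_rank_Suc_row[OF assms, of "i + a" l]) simp
  then show ?case using Suc by linarith
qed simp

lemma sw_rank_col_diff: "sw_rank w i (l + a) - a \<le> sw_rank w i l"
proof (induction a)
  case (Suc a)
  have "sw_rank w i (l + Suc a) \<le> sw_rank w i (l + a) + 1"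
    by (simp add: sw_rank_Suc_col)
  then show ?case using Suc by linarith
qed simp

text \<open>The lower bound is the rank of the same corner of the identity matrix.\<close>
lemma sw_rank_ge_diff:
  assumes "w permutes {1..n}"
  shows "l - i \<le> sw_rank w i l"
proof -
  have "0 < w a" if "1 \<le> a" for a
    using that permutes_in_image[OF assms, of a] permutes_not_in[OF assms, of a]
    by (cases "a \<in> {1..n}") auto
  then have "{a \<in> {1..l}. 0 < w a} = {1..l}" by auto
  then have "sw_rank w 0 l = l" by (simp add: sw_rank_def)
  then show ?thesis using sw_rank_row_diff[OF permutes_inj[OF assms], of 0 l i] by simp
qed

lemma sw_rank_swap:
  assumes "1 \<le> j" "j < k" "v j < v k"
  shows "sw_rank (v \<circ> transpose j k) i l =
    sw_rank v i l + (if j \<le> l \<and> l < k \<and> v j \<le> i \<and> i < v k then 1 else 0)"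
proof (induction l)
  case 0
  then show ?case using assms by simp
next
  case (Suc l)
  consider "Suc l = j" | "Suc l = k" | "Suc l \<noteq> j" "Suc l \<noteq> k" by blast
  then show ?case
  proof cases
    case 1
    then show ?thesis using Suc assms by (auto simp: sw_rank_Suc_col transpose_def)
  next
    case 2
    then show ?thesis using Suc assms by (auto simp: sw_rank_Suc_col transpose_def)
  next
    case 3
    then show ?thesis using Suc assms by (auto simp: sw_rank_Suc_col transpose_def)
  qed
qed

text \<open>
  The chain property of the Bruhat order: below \<open>w\<close>, and different from \<open>w\<close>, one can go up by a transposition
  and stay below \<open>w\<close>. Let \<open>j\<close> be the first position where \<open>v\<close> and \<open>w\<close> differ; then \<open>v j < w j\<close>. Among the later
  positions with a value in the interval from \<open>v j\<close> (excluded) to \<open>w j\<close>, let \<open>k\<close> be the first. The swap of \<open>j\<close> and \<open>k\<close>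
  raises by one the ranks for \<open>j \<le> l < k\<close> and \<open>v j \<le> i < v k\<close>, and there \<open>w\<close> is strictly ahead of \<open>v\<close>: it
  has the additional value \<open>w j\<close> in the interval, while \<open>v\<close> has none there between the positions \<open>j\<close> and \<open>k\<close>.
\<close>
lemma ascent_below:
  assumes v: "v permutes {1..n}" and w: "w permutes {1..n}"
    and le: "\<And>i l. l \<le> n \<Longrightarrow> sw_rank v i l \<le> sw_rank w i l" and ne: "v \<noteq> w"
  obtains j k where "1 \<le> j" "j < k" "k \<le> n" "v j < v k"
    "\<And>i l. l \<le> n \<Longrightarrow> sw_rank (v \<circ> transpose j k) i l \<le> sw_rank w i l"
proof -
  define j where "j = (LEAST j. v j \<noteq> w j)"
  have ex: "\<exists>j. v j \<noteq> w j" using ne by auto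
  have jne: "v j \<noteq> w j" unfolding j_def using LeastI_ex[OF ex] .
  have agree: "v a = w a" if "a < j" for a
    using not_less_Least[OF that[unfolded j_def]] by simp
  have j: "j \<in> {1..n}"
    using jne permutes_not_in[OF v, of j] permutes_not_in[OF w, of j] by metis
  then obtain j' where j': "j = Suc j'" by (cases j) auto
  have low: "sw_rank v i j' = sw_rank w i j'" for i
    unfolding sw_rank_def by (rule arg_cong[where f = card]) (use agree j' in auto)
  have vwj: "v j < w j"
  proof (rule ccontr)
    assume "\<not> v j < w j"
    then have "w j < v j" using jne by simp
    then show False
      using le[of j "w j"] j low[of "w j"] by (simp add: j' sw_rank_Suc_col)
  qed
  obtain k0 where k0: "v k0 = w j" using permutes_surj[OF v] by (metis surjD)
  have k0j: "j < k0"
  proof (rule ccontr)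
    assume "\<not> j < k0"
    then have "k0 < j" using k0 jne by (cases "k0 = j") auto
    then show False using agree[of k0] k0 permutes_inj[OF w] by (metis injD less_irrefl)
  qed
  have k0n: "k0 \<le> n"
    using k0 k0j j permutes_in_image[OF w, of j] permutes_not_in[OF v, of k0]
    by (cases "k0 \<in> {1..n}") auto
  define k where "k = (LEAST k. j < k \<and> v j < v k \<and> v k \<le> w j)"
  have k: "j < k \<and> v j < v k \<and> v k \<le> w j"
    unfolding k_def by (rule LeastI[of _ k0]) (use k0 k0j vwj in auto)
  have "k \<le> k0" unfolding k_def by (rule Least_le) (use k0 k0j vwj in auto)
  have kmin: "\<not> (v j < v a \<and> v a \<le> w j)" if "j < a" "a < k" for a
    using not_less_Least[OF that(2)[unfolded k_def]] that(1) by blast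
  have strict: "sw_rank v i l < sw_rank w i l"
    if "j \<le> l" "l < k" "v j \<le> i" "i < v k" for i l
  proof -
    have i: "i \<le> w j" "i < w j" using that k by auto
    let ?S = "{a \<in> {1..<j}. i < w a \<and> w a \<le> w j}"
    have "{a \<in> {1..l}. i < v a \<and> v a \<le> w j} = ?S"
    proof (intro equalityI subsetI)
      fix a assume a: "a \<in> {a \<in> {1..l}. i < v a \<and> v a \<le> w j}"
      then have "a < j" using kmin[of a] that by (cases a j rule: linorder_cases) auto
      then show "a \<in> ?S" using a agree by auto
    next
      fix a assume "a \<in> ?S"
      then show "a \<in> {a \<in> {1..l}. i < v a \<and> v a \<le> w j}" using agree that by auto
    qed
    moreover have "insert j ?S \<subseteq> {a \<in> {1..l}. i < w a \<and> w a \<le> w j}"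
      using that j i by auto
    then have "card (insert j ?S) \<le> card {a \<in> {1..l}. i < w a \<and> w a \<le> w j}"
      by (intro card_mono) auto
    ultimately have "card {a \<in> {1..l}. i < v a \<and> v a \<le> w j}
        < card {a \<in> {1..l}. i < w a \<and> w a \<le> w j}"
      by simp
    moreover have "sw_rank v (w j) l \<le> sw_rank w (w j) l"
      using le[of l "w j"] that \<open>k \<le> k0\<close> k0n by simp
    ultimately show ?thesis
      using sw_rank_split_row[OF i(1), of v l] sw_rank_split_row[OF i(1), of w l] by simp
  qed
  show ?thesis
  proof (rule that[of j k])
    show "1 \<le> j" "j < k" "k \<le> n" "v j < v k" using j k \<open>k \<le> k0\<close> k0n by auto
    then show "sw_rank (v \<circ> transpose j k) i l \<le> sw_rank w i l" if "l \<le> n" for i l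
      using strict[of l i] le[OF that, of i] Suc_leI by (auto simp: sw_rank_swap)
  qed
qed

text \<open>
  Induction down the Bruhat order from \<open>w\<close>, where the order is given by comparison of all corner ranks.
\<close>
lemma bruhat_descend:
  assumes v: "v permutes {1..n}" and w: "w permutes {1..n}"
    and le: "\<And>i l. l \<le> n \<Longrightarrow> sw_rank v i l \<le> sw_rank w i l"
    and top: "P w"
    and down: "\<And>u j k. u permutes {1..n} \<Longrightarrow> 1 \<le> j \<Longrightarrow> j < k \<Longrightarrow> k \<le> n \<Longrightarrow> u j < u k
       \<Longrightarrow> P (u \<circ> transpose j k) \<Longrightarrow> P u"
  shows "P v"
  using v le
proof (induction "(\<Sum>i\<le>n. \<Sum>l\<le>n. sw_rank w i l) - (\<Sum>i\<le>n. \<Sum>l\<le>n. sw_rank v i l)"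
    arbitrary: v rule: less_induct)
  case less
  show ?case
  proof (cases "v = w")
    case True
    then show ?thesis using top by simp
  next
    case False
    from ascent_below[OF less.prems(1) w less.prems(2) False]
    obtain j k where jk: "1 \<le> j" "j < k" "k \<le> n" "v j < v k"
      and le': "\<And>i l. l \<le> n \<Longrightarrow> sw_rank (v \<circ> transpose j k) i l \<le> sw_rank w i l"
      by metis
    let ?u = "v \<circ> transpose j k"
    have u: "?u permutes {1..n}"
      using jk by (intro permutes_compose[OF permutes_swap_id less.prems(1)]) auto
    have vj: "v j \<le> n"
      using permutes_in_image[OF less.prems(1), of j] jk by auto
    have lt: "(\<Sum>i\<le>n. \<Sum>l\<le>n. sw_rank v i l) < (\<Sum>i\<le>n. \<Sum>l\<le>n. sw_rank ?u i l)"
    proof (rule sum_strict_mono_ex1)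
      show "\<forall>i\<in>{..n}. (\<Sum>l\<le>n. sw_rank v i l) \<le> (\<Sum>l\<le>n. sw_rank ?u i l)"
        using jk by (auto intro!: sum_mono simp: sw_rank_swap)
      have "(\<Sum>l\<le>n. sw_rank v (v j) l) < (\<Sum>l\<le>n. sw_rank ?u (v j) l)"
        by (rule sum_strict_mono_ex1) (use jk in \<open>auto simp: sw_rank_swap intro!: bexI[of _ j]\<close>)
      then show "\<exists>i\<in>{..n}. (\<Sum>l\<le>n. sw_rank v i l) < (\<Sum>l\<le>n. sw_rank ?u i l)"
        using vj by auto
    qed simp
    moreover have "(\<Sum>i\<le>n. \<Sum>l\<le>n. sw_rank ?u i l) \<le> (\<Sum>i\<le>n. \<Sum>l\<le>n. sw_rank w i l)"
      by (intro sum_mono le') auto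
    ultimately have "P ?u" by (intro less.hyps[OF _ u le']) auto
    then show ?thesis using down[OF less.prems(1) jk] by blast
  qed
qed

section \<open>Diagram boxes on or above the diagonal\<close>

text \<open>
  The box of the Rothe diagram in the row with index \<open>i\<close> and the \<open>l\<close>-th column, that is, with matrix index
  \<open>(i, l - 1)\<close>: the one of its column is above it and the one of its row is to the right of it. The
  condition \<open>i < l\<close> puts it on or above the diagonal.
\<close>
definition upper_diagram_box :: "nat \<Rightarrow> (nat \<Rightarrow> nat) \<Rightarrow> nat \<Rightarrow> nat \<Rightarrow> bool" where
  "upper_diagram_box n w i l \<longleftrightarrow> i < l \<and> l \<le> n \<and> w l \<le> i \<and> (\<forall>a\<in>{1..l}. w a \<noteq> Suc i)"

text \<open>
  Induction on the distance to the region below the diagonal. If the place is not a diagram box, then the one of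
  \<open>w\<close> in the last column or in the first row of the corner lies inside the corner. Removing that
  column or row lowers the rank for \<open>w\<close> by one, and the rank for \<open>v\<close> by at most one.
\<close>
lemma sw_rank_le_if_le_below_diagonal:
  assumes v: "v permutes {1..n}" and w: "w permutes {1..n}"
    and no_box: "\<And>i l. \<not> upper_diagram_box n w i l"
    and le: "\<And>i l. l \<le> n \<Longrightarrow> l \<le> i \<Longrightarrow> sw_rank v i l \<le> sw_rank w i l"
    and l: "l \<le> n"
  shows "sw_rank v i l \<le> sw_rank w i l"
  using l
proof (induction "l - i" arbitrary: i l)
  case 0
  then show ?case using le by simp
next
  case (Suc d)
  then obtain l' where l': "l = Suc l'" by (cases l) auto
  have "i < w l \<or> (\<exists>a\<in>{1..l}. w a = Suc i)"
    using no_box[of i l] Suc by (auto simp: upper_diagram_box_def)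
  then show ?case
  proof
    assume "i < w l"
    moreover have "sw_rank v i l' \<le> sw_rank w i l'" using Suc l' by auto
    ultimately show ?thesis by (simp add: l' sw_rank_Suc_col)
  next
    assume "\<exists>a\<in>{1..l}. w a = Suc i"
    moreover have "sw_rank v (Suc i) l \<le> sw_rank w (Suc i) l"
      using Suc.hyps Suc.prems by auto
    ultimately show ?thesis
      using sw_rank_Suc_row[OF permutes_inj[OF v], of i l]
        sw_rank_Suc_row[OF permutes_inj[OF w], of i l] by auto
  qed
qed

text \<open>
  A box \<open>(i, l)\<close> contradicts the maximality of \<open>w_perm n D l\<close>: the value \<open>Suc i \<le> l\<close> is never excluded by
  \<open>M_roots\<close> at the position \<open>l\<close>, is unused, and exceeds the value taken. Conversely, take for \<open>D\<close> the
  excedances of \<open>w\<close>. A candidate \<open>i > j\<close> at the position \<open>j\<close> is outside \<open>M_roots\<close> only if it is in \<open>D\<close>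
  (then it is \<open>w j\<close>), if \<open>D\<close> has a root to the left in its row (then \<open>i\<close> is used already), or if \<open>D\<close> has a
  root below in its column (then \<open>w j > i\<close>). A candidate \<open>i \<le> j\<close> greater than \<open>w j\<close> would give a box.
\<close>
lemma w_perm_eq_iff_no_upper_diagram_box:
  assumes w: "w permutes {1..n}"
  shows "(\<exists>D. basic n D \<and> w = w_perm n D) \<longleftrightarrow> (\<forall>i l. \<not> upper_diagram_box n w i l)"
proof (intro iffI allI notI)
  fix i l
  assume "\<exists>D. basic n D \<and> w = w_perm n D" and box: "upper_diagram_box n w i l"
  then obtain D where D: "w = w_perm n D" by blast
  let ?A = "{i \<in> {1..n}. (i, l) \<notin> M_roots n D \<and> i \<notin> w_perm n D ` {1..<l}}"
  have "Suc i \<in> ?A"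
    using box unfolding upper_diagram_box_def D[symmetric]
    by (auto simp: M_roots_def regular_roots_def positive_roots_def)
  then have "Suc i \<le> Max ?A" by (intro Max_ge) auto
  also have "Max ?A = w l"
    using box D by (subst D, subst w_perm.simps) (auto simp: upper_diagram_box_def)
  finally show False using box by (simp add: upper_diagram_box_def)
next
  assume no_box: "\<forall>i l. \<not> upper_diagram_box n w i l"
  define D where "D = {(i, j). j \<in> {1..n} \<and> i = w j \<and> j < w j}"
  have inj: "w a = w b \<Longrightarrow> a = b" for a b using permutes_inj[OF w] by (auto dest: injD)
  have rng: "w a \<in> {1..n}" if "a \<in> {1..n}" for a using that permutes_in_image[OF w] by blast
  have D: "basic n D"
    unfolding basic_def positive_roots_def D_def inj_on_def
    using rng inj by (auto simp: atLeastAtMost_iff)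
  have "w_perm n D j = w j" for j
  proof (induction j rule: less_induct)
    case (less j)
    show ?case
    proof (cases "j \<in> {1..n}")
      case False
      then show ?thesis
        using permutes_not_in[OF w False] by (subst w_perm.simps) auto
    next
      case True
      let ?A = "{i \<in> {1..n}. (i, j) \<notin> M_roots n D \<and> i \<notin> w_perm n D ` {1..<j}}"
      have img: "w_perm n D ` {1..<j} = w ` {1..<j}"
        using less by (intro image_cong) auto
      have "Max ?A = w j"
      proof (rule Max_eqI)
        show "finite ?A" by simp
        have "(w j, j) \<notin> M_roots n D"
          using True rng[OF True]
          by (cases "j < w j")
            (auto simp: M_roots_def regular_roots_def positive_roots_def D_def)
        moreover have "w j \<notin> w ` {1..<j}" using inj by fastforce
        ultimately show "w j \<in> ?A" using rng[OF True] img by auto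
        fix i assume "i \<in> ?A"
        then have i: "i \<in> {1..n}" "(i, j) \<notin> M_roots n D" "i \<notin> w ` {1..<j}"
          using img by auto
        show "i \<le> w j"
        proof (rule ccontr)
          assume "\<not> i \<le> w j"
          then have gt: "w j < i" by simp
          show False
          proof (cases "j < i")
            case False
            have "upper_diagram_box n w (i - 1) j"
              unfolding upper_diagram_box_def
            proof (intro conjI ballI)
              fix a assume a: "a \<in> {1..j}"
              show "w a \<noteq> Suc (i - 1)"
                using a i gt by (cases "a = j") auto
            qed (use False i gt True in auto)
            then show False using no_box by blast
          next
            case True2: True
            have pos: "(i, j) \<in> positive_roots n"
              using True2 i True by (auto simp: positive_roots_def)
            have "(i, j) \<notin> D" using gt by (auto simp: D_def)
            then have "(i, j) \<in> singular_roots n D"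
              using i(2) pos by (auto simp: M_roots_def regular_roots_def)
            then obtain \<beta> \<gamma> where \<gamma>: "\<gamma> \<in> D" "root_sum (i, j) \<beta> \<gamma>"
              by (auto simp: singular_roots_def)
            then obtain a b c where abc: "a > b" "b > c" "\<gamma> = (a, c)"
              "{(i, j), \<beta>} = {(a, b), (b, c)}"
              unfolding root_sum_def by blast
            then have "(i, j) = (a, b) \<or> (i, j) = (b, c)" by (auto simp: doubleton_eq_iff)
            then show False
            proof
              assume "(i, j) = (a, b)"
              then show False using \<gamma>(1) abc i(3) by (auto simp: D_def)
            next
              assume "(i, j) = (b, c)"
              then show False using \<gamma>(1) abc gt by (auto simp: D_def)
            qed
          qed
        qed
      qed
      then show ?thesis using True by (subst w_perm.simps) auto
    qed
  qed
  then have "w = w_perm n D" by auto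
  then show "\<exists>D. basic n D \<and> w = w_perm n D" using D by blast
qed

section \<open>The groups and the cosets\<close>
lemma mat_mult_entry:
  assumes "A \<in> carrier_mat n m" "B \<in> carrier_mat m p" "x < n" "y < p"
  shows "(A * B) $$ (x, y) = (\<Sum>z<m. A $$ (x, z) * B $$ (z, y))"
  using assms by (auto simp: scalar_prod_def lessThan_atLeast0 intro!: sum.cong)

lemma GL_iff_det:
  "A \<in> carrier (GL n) \<longleftrightarrow> A \<in> carrier_mat n n \<and> det A \<noteq> 0"
  using det_non_zero_imp_unit[of A n "()"] unit_imp_det_non_zero[of A n "()"]
  by (auto simp: GL_def units_of_def Units_def ring_mat_def)

lemma GL_mult: "A \<in> carrier (GL n) \<Longrightarrow> B \<in> carrier (GL n) \<Longrightarrow> A * B \<in> carrier (GL n)"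
  by (auto simp: GL_iff_det det_mult)

lemma GL_inverse:
  assumes "A \<in> carrier (GL n)"
  obtains B where "B \<in> carrier_mat n n" "A * B = 1\<^sub>m n" "B * A = 1\<^sub>m n"
  using assms by (auto simp: GL_def units_of_def Units_def ring_mat_def)

lemma Borel_iff: "A \<in> Borel n \<longleftrightarrow> A \<in> carrier_mat n n \<and> det A \<noteq> 0 \<and> upper_triangular A"
  by (auto simp: Borel_def GL_iff_det)

lemma Borel_one: "1\<^sub>m n \<in> Borel n"
  by (auto simp: Borel_iff)

lemma Borel_mult:
  assumes "A \<in> Borel n" "B \<in> Borel n"
  shows "A * B \<in> Borel n"
proof -
  have c: "A \<in> carrier_mat n n" "B \<in> carrier_mat n n" using assms by (auto simp: Borel_iff)
  have "upper_triangular (A * B)"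
  proof (rule upper_triangularI)
    fix i j assume ij: "j < i" "i < dim_row (A * B)"
    then have "(A * B) $$ (i, j) = (\<Sum>z<n. A $$ (i, z) * B $$ (z, j))"
      using c by (intro mat_mult_entry[where n=n and m=n and p=n]) auto
    also have "\<dots> = 0"
    proof (rule sum.neutral, rule ballI)
      fix z assume "z \<in> {..<n}"
      then have "A $$ (i, z) = 0 \<or> B $$ (z, j) = 0"
        using ij c assms by (cases "z < i") (auto simp: Borel_iff upper_triangular_def)
      then show "A $$ (i, z) * B $$ (z, j) = 0" by auto
    qed
    finally show "(A * B) $$ (i, j) = 0" .
  qed
  then show ?thesis using assms by (auto simp: Borel_iff det_mult)
qed

text \<open>
  The inverse is again upper triangular: in \<open>B * A = 1\<close>, the entry \<open>(i, j)\<close> with \<open>j < i\<close> reads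
  \<open>B $$ (i, j) * A $$ (j, j) = 0\<close> as soon as the entries of \<open>B\<close> to the left of it in the row are known to vanish.
\<close>
lemma Borel_inverse:
  assumes A: "A \<in> Borel n"
  obtains B where "B \<in> Borel n" "A * B = 1\<^sub>m n" "B * A = 1\<^sub>m n"
proof -
  have Ac: "A \<in> carrier_mat n n" "upper_triangular A" "det A \<noteq> 0"
    using A by (auto simp: Borel_iff)
  obtain B where B: "B \<in> carrier_mat n n" "A * B = 1\<^sub>m n" "B * A = 1\<^sub>m n"
    using A GL_inverse by (auto simp: Borel_def)
  have diag: "A $$ (j, j) \<noteq> 0" if "j < n" for j
  proof -
    have "A $$ (j, j) \<in> set (diag_mat A)" using that Ac by (auto simp: diag_mat_def)
    then show ?thesis using Ac det_upper_triangular[OF Ac(2,1)] by (auto simp: prod_list_zero_iff)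
  qed
  have zero: "B $$ (i, j) = 0" if "i < n" "j < i" for i j
    using that
  proof (induction j rule: less_induct)
    case (less j)
    have "0 = (B * A) $$ (i, j)" using B(3) less.prems by simp
    also have "\<dots> = (\<Sum>z<n. B $$ (i, z) * A $$ (z, j))"
      using B Ac less.prems by (intro mat_mult_entry[where n=n and m=n and p=n]) auto
    also have "\<dots> = (\<Sum>z<n. if z = j then B $$ (i, j) * A $$ (j, j) else 0)"
    proof (rule sum.cong[OF refl])
      fix z assume "z \<in> {..<n}"
      then show "B $$ (i, z) * A $$ (z, j) = (if z = j then B $$ (i, j) * A $$ (j, j) else 0)"
        using less Ac by (cases z j rule: linorder_cases) (auto simp: upper_triangular_def)
    qed
    also have "\<dots> = B $$ (i, j) * A $$ (j, j)" using less.prems by simp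
    finally show ?case using diag[of j] less.prems by simp
  qed
  have "det A * det B = 1" using det_mult[OF Ac(1) B(1)] B(2) by simp
  then have "B \<in> Borel n"
    unfolding Borel_iff upper_triangular_def using B(1) zero by auto
  then show ?thesis using that B by blast
qed

lemma mod_Borel_eq: "mod_Borel n g = (\<lambda>b. g * b) ` Borel n"
  by (auto simp: l_coset_def GL_def units_of_def ring_mat_def)

lemma mod_Borel_refl: "g \<in> carrier_mat n n \<Longrightarrow> g \<in> mod_Borel n g"
  unfolding mod_Borel_eq using Borel_one by (auto intro!: image_eqI[of _ _ "1\<^sub>m n"])

lemma mod_Borel_eqD:
  assumes "mod_Borel n g = mod_Borel n g'" "g \<in> carrier_mat n n"
  obtains b where "b \<in> Borel n" "g = g' * b"
  using mod_Borel_refl[OF assms(2)] assms(1) unfolding mod_Borel_eq by auto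

lemma Borel_carrier: "b \<in> Borel n \<Longrightarrow> b \<in> carrier_mat n n"
  by (simp add: Borel_iff)

lemma mod_Borel_mult:
  assumes g: "g \<in> carrier_mat n n" and b: "b \<in> Borel n"
  shows "mod_Borel n (g * b) = mod_Borel n g"
proof -
  note bc = Borel_carrier
  obtain d where d: "d \<in> Borel n" "b * d = 1\<^sub>m n" using b Borel_inverse by blast
  show ?thesis
    unfolding mod_Borel_eq
  proof (intro equalityI subsetI)
    fix x assume "x \<in> (\<lambda>c. g * b * c) ` Borel n"
    then obtain c where "c \<in> Borel n" "x = g * b * c" by blast
    then have "x = g * (b * c)" "b * c \<in> Borel n"
      using g b bc Borel_mult by (auto intro!: assoc_mult_mat[of _ n n _ n _ n])
    then show "x \<in> (\<lambda>c. g * c) ` Borel n" by blast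
  next
    fix x assume "x \<in> (\<lambda>c. g * c) ` Borel n"
    then obtain c where c: "c \<in> Borel n" "x = g * c" by blast
    have carr: "b \<in> carrier_mat n n" "c \<in> carrier_mat n n" "d \<in> carrier_mat n n"
      using b c d bc by blast+
    have "g * b * (d * c) = g * (b * (d * c))"
      by (rule assoc_mult_mat[of _ n n _ n _ n]) (use g carr in auto)
    also have "b * (d * c) = b * d * c"
      by (rule assoc_mult_mat[of _ n n _ n _ n, symmetric]) (use carr in auto)
    also have "g * \<dots> = x" using d(2) c(2) carr by simp
    finally show "x \<in> (\<lambda>c. g * b * c) ` Borel n"
      using Borel_mult[OF d(1) c(1)] by auto
  qed
qed

section \<open>Polynomial functions and closed sets\<close>
lemma poly_funs_sum:
  assumes "finite S" "\<And>s. s \<in> S \<Longrightarrow> f s \<in> poly_funs n"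
  shows "(\<lambda>A. \<Sum>s\<in>S. f s A) \<in> poly_funs n"
  using assms
proof (induction S rule: finite_induct)
  case empty
  then show ?case using poly_funs.const[of 0 n] by simp
next
  case (insert x S)
  then show ?case using poly_funs.add[of "f x" n "\<lambda>A. \<Sum>s\<in>S. f s A"] by simp
qed

lemma poly_funs_prod:
  assumes "finite S" "\<And>s. s \<in> S \<Longrightarrow> f s \<in> poly_funs n"
  shows "(\<lambda>A. \<Prod>s\<in>S. f s A) \<in> poly_funs n"
  using assms
proof (induction S rule: finite_induct)
  case empty
  then show ?case using poly_funs.const[of 1 n] by simp
next
  case (insert x S)
  then show ?case using poly_funs.mult[of "f x" n "\<lambda>A. \<Prod>s\<in>S. f s A"] by simp
qed

definition minor :: "nat \<Rightarrow> (nat \<Rightarrow> nat) \<Rightarrow> (nat \<Rightarrow> nat) \<Rightarrow> 'a::field mat \<Rightarrow> 'a" where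
  "minor k R C A = det (mat k k (\<lambda>(a, b). A $$ (R a, C b)))"

lemma minor_poly_fun:
  assumes "\<And>a. a < k \<Longrightarrow> R a < n" "\<And>a. a < k \<Longrightarrow> C a < n"
  shows "(minor k R C :: 'a::field mat \<Rightarrow> 'a) \<in> poly_funs n"
proof -
  have eq: "(minor k R C :: 'a mat \<Rightarrow> 'a) = (\<lambda>A. \<Sum>p\<in>{p. p permutes {0..<k}}.
      of_int (sign p) * (\<Prod>a\<in>{0..<k}. A $$ (R a, C (p a))))"
  proof (rule ext)
    fix A :: "'a mat"
    have "(\<Prod>a\<in>{0..<k}. mat k k (\<lambda>(a, b). A $$ (R a, C b)) $$ (a, p a)) =
        (\<Prod>a\<in>{0..<k}. A $$ (R a, C (p a)))" if "p permutes {0..<k}" for p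
      by (intro prod.cong refl) (use permutes_in_image[OF that] in auto)
    then show "minor k R C A = (\<Sum>p\<in>{p. p permutes {0..<k}}.
      of_int (sign p) * (\<Prod>a\<in>{0..<k}. A $$ (R a, C (p a))))"
      unfolding minor_def by (subst det_def'[of _ k]) auto
  qed
  show ?thesis
    unfolding eq
  proof (intro poly_funs_sum poly_funs.mult poly_funs.const poly_funs_prod)
    fix p :: "nat \<Rightarrow> nat" and a :: nat assume "p \<in> {p. p permutes {0..<k}}" and a: "a \<in> {0..<k}"
    then have "p a < k" using permutes_in_image[of p "{0..<k}" a] by auto
    then show "(\<lambda>A. A $$ (R a, C (p a))) \<in> poly_funs n"
      using assms a by (intro poly_funs.entry) auto
  qed (auto intro: finite_permutations)
qed

lemma poly_funs_translate:
  assumes "f \<in> poly_funs n" and c: "c \<in> carrier_mat n n" "c' \<in> carrier_mat n n"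
  shows "\<exists>f'\<in>poly_funs n. \<forall>A\<in>carrier_mat n n. f' A = f (c * A * c')"
  using assms(1)
proof induction
  case (const a)
  show ?case by (rule bexI[of _ "\<lambda>A. a", OF _ poly_funs.const]) simp
next
  case (entry i j)
  let ?f = "\<lambda>A. \<Sum>z\<in>{..<n}. (\<Sum>y\<in>{..<n}. c $$ (i, y) * A $$ (y, z)) * c' $$ (z, j)"
  have "?f \<in> poly_funs n"
    by (intro poly_funs_sum poly_funs.mult poly_funs.const poly_funs.entry) auto
  moreover have "?f A = (c * A * c') $$ (i, j)" if "A \<in> carrier_mat n n" for A
  proof -
    have "(c * A * c') $$ (i, j) = (\<Sum>z\<in>{..<n}. (c * A) $$ (i, z) * c' $$ (z, j))"
      by (rule mat_mult_entry[where n=n and m=n and p=n]) (use that c entry in auto)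
    also have "\<dots> = ?f A"
    proof (rule sum.cong[OF refl])
      fix z assume "z \<in> {..<n}"
      then have "(c * A) $$ (i, z) = (\<Sum>y\<in>{..<n}. c $$ (i, y) * A $$ (y, z))"
        by (intro mat_mult_entry[where n=n and m=n and p=n]) (use that c entry in auto)
      then show "(c * A) $$ (i, z) * c' $$ (z, j) =
          (\<Sum>y\<in>{..<n}. c $$ (i, y) * A $$ (y, z)) * c' $$ (z, j)" by simp
    qed
    finally show ?thesis by simp
  qed
  ultimately show ?case by (intro bexI[of _ ?f]) auto
next
  case (add f g)
  then obtain f' g' where "f' \<in> poly_funs n" "g' \<in> poly_funs n"
    "\<forall>A\<in>carrier_mat n n. f' A = f (c * A * c')" "\<forall>A\<in>carrier_mat n n. g' A = g (c * A * c')"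
    by blast
  then show ?case by (intro bexI[of _ "\<lambda>A. f' A + g' A", OF _ poly_funs.add]) simp_all
next
  case (mult f g)
  then obtain f' g' where "f' \<in> poly_funs n" "g' \<in> poly_funs n"
    "\<forall>A\<in>carrier_mat n n. f' A = f (c * A * c')" "\<forall>A\<in>carrier_mat n n. g' A = g (c * A * c')"
    by blast
  then show ?case by (intro bexI[of _ "\<lambda>A. f' A * g' A", OF _ poly_funs.mult]) simp_all
qed

lemma poly_funs_on_curve:
  fixes F :: "'a::field \<Rightarrow> 'a mat"
  assumes "f \<in> poly_funs n"
    and "\<And>i j. i < n \<Longrightarrow> j < n \<Longrightarrow> \<exists>p. \<forall>s. F s $$ (i, j) = poly p s"
  shows "\<exists>p. \<forall>s. f (F s) = poly p s"
  using assms(1)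
proof induction
  case (const a)
  then show ?case by (intro exI[of _ "[:a:]"]) simp
next
  case (entry i j)
  then show ?case using assms(2) by blast
next
  case (add f g)
  then show ?case by (metis poly_add)
next
  case (mult f g)
  then show ?case by (metis poly_mult)
qed

text \<open>
  This is how closures enter: a closed set that contains all but finitely many points of a line contains the line.
\<close>
lemma poly_fun_zero_on_line:
  fixes M N :: "'a::field_char_0 mat"
  assumes f: "f \<in> poly_funs n" and M: "M \<in> carrier_mat n n" and N: "N \<in> carrier_mat n n"
    and S: "finite S" and zero: "\<And>s. s \<notin> S \<Longrightarrow> f (M + s \<cdot>\<^sub>m N) = 0"
  shows "f (M + s \<cdot>\<^sub>m N) = 0"
proof -
  have "\<exists>p. \<forall>s. f (M + s \<cdot>\<^sub>m N) = poly p s"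
  proof (rule poly_funs_on_curve[OF f])
    fix i j assume "i < n" "j < n"
    then show "\<exists>p. \<forall>s. (M + s \<cdot>\<^sub>m N) $$ (i, j) = poly p s"
      using M N by (intro exI[of _ "[:M $$ (i, j), N $$ (i, j):]"]) auto
  qed
  then obtain p where p: "f (M + s \<cdot>\<^sub>m N) = poly p s" for s by blast
  have "p = 0"
  proof (rule ccontr)
    assume "p \<noteq> 0"
    then have "finite {s. poly p s = 0}" by (rule poly_roots_finite)
    moreover have "- S \<subseteq> {s. poly p s = 0}" using zero p by auto
    ultimately have "finite (- S)" by (rule rev_finite_subset)
    then show False using S infinite_UNIV_char_0[where 'a = 'a] by simp
  qed
  then show ?thesis using p by simp
qed

text \<open>
  Imposing a polynomial equation together with all its translates by \<open>B\<close> on both sides makes the zero set a union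
  of cosets, hence the preimage of a closed set of flags. For a minor of a corner this replaces the verification
  that the ideal of minors is stable under \<open>B\<close>.
\<close>
lemma zariski_closed_translates:
  fixes f :: "'a::field mat \<Rightarrow> 'a"
  assumes f: "f \<in> poly_funs n"
  defines "Z \<equiv> {g \<in> carrier (GL n). \<forall>c\<in>Borel n. \<forall>c'\<in>Borel n. f (c * g * c') = 0}"
  shows "zariski_closed n (mod_Borel n ` Z)"
    and "g \<in> carrier (GL n) \<Longrightarrow> mod_Borel n g \<in> mod_Borel n ` Z \<longleftrightarrow> g \<in> Z"
proof -
  have saturated: "g \<in> Z" if "g \<in> carrier (GL n)" "mod_Borel n g \<in> mod_Borel n ` Z" for g
  proof -
    obtain g' where g': "g' \<in> Z" "mod_Borel n g = mod_Borel n g'" using \<open>mod_Borel n g \<in> _\<close> by blast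
    then obtain b where b: "b \<in> Borel n" "g = g' * b"
      using mod_Borel_eqD \<open>g \<in> carrier (GL n)\<close> GL_iff_det by metis
    have "f (c * g * c') = 0" if c: "c \<in> Borel n" "c' \<in> Borel n" for c c'
    proof -
      have carr: "c \<in> carrier_mat n n" "c' \<in> carrier_mat n n" "b \<in> carrier_mat n n"
          "g' \<in> carrier_mat n n"
        using c b g' by (auto simp: Borel_carrier Z_def GL_iff_det)
      have "c * g * c' = c * g' * b * c'"
        unfolding b(2) by (subst assoc_mult_mat[of c n n g' n b n, symmetric]) (use carr in auto)
      also have "\<dots> = c * g' * (b * c')"
        by (rule assoc_mult_mat[of _ n n _ n _ n]) (use carr in auto)
      finally show ?thesis using g'(1) c Borel_mult[OF b(1) c(2)] by (auto simp: Z_def)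
    qed
    then show "g \<in> Z" using \<open>g \<in> carrier (GL n)\<close> by (auto simp: Z_def)
  qed
  show "mod_Borel n g \<in> mod_Borel n ` Z \<longleftrightarrow> g \<in> Z" if "g \<in> carrier (GL n)"
    using saturated[OF that] by blast
  let ?P = "{f' \<in> poly_funs n. \<exists>c\<in>Borel n. \<exists>c'\<in>Borel n. \<forall>A\<in>carrier_mat n n. f' A = f (c * A * c')}"
  have "{g \<in> carrier (GL n). mod_Borel n g \<in> mod_Borel n ` Z} = Z"
    using saturated by (auto simp: Z_def)
  also have "Z = {g \<in> carrier (GL n). \<forall>f\<in>?P. f g = 0}"
  proof (intro equalityI subsetI)
    fix g assume "g \<in> Z"
    then show "g \<in> {g \<in> carrier (GL n). \<forall>f\<in>?P. f g = 0}"
      by (fastforce simp: Z_def GL_iff_det)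
  next
    fix g assume g: "g \<in> {g \<in> carrier (GL n). \<forall>f\<in>?P. f g = 0}"
    have "f (c * g * c') = 0" if c: "c \<in> Borel n" "c' \<in> Borel n" for c c'
    proof -
      obtain f' where "f' \<in> poly_funs n" "\<forall>A\<in>carrier_mat n n. f' A = f (c * A * c')"
        using poly_funs_translate[OF f] Borel_carrier c by meson
      then have "f' \<in> ?P" using c by blast
      then have "f' g = 0" using g by blast
      then show ?thesis using \<open>\<forall>A\<in>carrier_mat n n. f' A = f (c * A * c')\<close> g
        by (auto simp: GL_iff_det)
    qed
    then show "g \<in> Z" using g by (auto simp: Z_def)
  qed
  finally have "{g \<in> carrier (GL n). mod_Borel n g \<in> mod_Borel n ` Z}
      = {g \<in> carrier (GL n). \<forall>f\<in>?P. f g = 0}" .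
  moreover have "mod_Borel n ` Z \<subseteq> flag_variety n" by (auto simp: flag_variety_def Z_def)
  ultimately show "zariski_closed n (mod_Borel n ` Z)"
    unfolding zariski_closed_def by (intro conjI exI[of _ ?P]) auto
qed

lemma perm_matrix_carrier [simp]: "perm_matrix n w \<in> carrier_mat n n"
  by (simp add: perm_matrix_def)

lemma perm_matrix_dims [simp]: "dim_row (perm_matrix n w) = n" "dim_col (perm_matrix n w) = n"
  by (simp_all add: perm_matrix_def)

lemma perm_matrix_entry:
  "x < n \<Longrightarrow> y < n \<Longrightarrow> perm_matrix n w $$ (x, y) = (if w (Suc y) = Suc x then 1 else 0)"
  by (simp add: perm_matrix_def)

lemma perm_matrix_GL:
  assumes w: "w permutes {1..n}"
  shows "(perm_matrix n w :: 'a::field mat) \<in> carrier (GL n)"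
proof -
  let ?A = "perm_matrix n w :: 'a mat"
  have "?A * transpose_mat ?A = 1\<^sub>m n"
  proof (rule eq_matI)
    fix x y assume "x < dim_row (1\<^sub>m n :: 'a mat)" "y < dim_col (1\<^sub>m n :: 'a mat)"
    then have xy: "x < n" "y < n" by auto
    obtain m' where m': "w m' = Suc x" using permutes_surj[OF w] by (metis surjD)
    have m'_range: "m' \<in> {1..n}"
      using permutes_in_image[OF w, of m'] m' xy by auto
    then obtain m where "m' = Suc m" by (cases m') auto
    then have m: "m < n" "w (Suc m) = Suc x" using m' m'_range by auto
    have eq: "w (Suc z) = Suc x \<longleftrightarrow> z = m" for z
      using m(2) permutes_inj[OF w] by (metis injD nat.inject)
    have "(?A * transpose_mat ?A) $$ (x, y) = (\<Sum>z<n. ?A $$ (x, z) * transpose_mat ?A $$ (z, y))"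
      using xy by (intro mat_mult_entry[where n=n and m=n and p=n]) auto
    also have "\<dots> = (\<Sum>z<n. if z = m then (if w (Suc m) = Suc y then 1 else 0) else 0)"
      using xy
      by (intro sum.cong refl) (auto simp: perm_matrix_entry eq)
    also have "\<dots> = (1\<^sub>m n :: 'a mat) $$ (x, y)" using m xy by simp
    finally show "(?A * transpose_mat ?A) $$ (x, y) = 1\<^sub>m n $$ (x, y)" .
  qed (auto simp: perm_matrix_def)
  moreover have "det (?A * transpose_mat ?A) = det ?A * det (transpose_mat ?A)"
    by (rule det_mult[of _ n]) auto
  ultimately show ?thesis by (auto simp: GL_iff_det)
qed

lemma addrow_mat_Borel:
  assumes "k < l"
  shows "addrow_mat n a k l \<in> Borel n"
proof -
  have "upper_triangular (addrow_mat n a k l)"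
    using assms by (auto simp: upper_triangular_def addrow_mat_def)
  then show ?thesis using assms det_addrow_mat[of k l n a] by (simp add: Borel_iff)
qed

lemma multrow_mat_Borel:
  assumes "k < n" "a \<noteq> 0"
  shows "multrow_mat n k a \<in> Borel n"
proof -
  have "upper_triangular (multrow_mat n k a)"
    by (auto simp: upper_triangular_def multrow_mat_def)
  then show ?thesis using assms det_multrow_mat[of k n a] by (simp add: Borel_iff)
qed

lemma Borel_double_coset_mult:
  assumes "g \<in> carrier_mat n n" "c \<in> Borel n" "c' \<in> Borel n" "b \<in> Borel n" "b' \<in> Borel n"
  shows "c * (b * g * b') * c' = (c * b) * g * (b' * c')"
proof -
  have carr: "c \<in> carrier_mat n n" "c' \<in> carrier_mat n n" "b \<in> carrier_mat n n" "b' \<in> carrier_mat n n"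
    using assms Borel_carrier by auto
  have "c * (b * g * b') * c' = c * (b * g) * b' * c'"
    by (subst assoc_mult_mat[of c n n "b * g" n b' n]) (use carr assms in auto)
  also have "c * (b * g) = c * b * g"
    by (subst assoc_mult_mat[of c n n b n g n]) (use carr assms in auto)
  also have "c * b * g * b' * c' = c * b * g * (b' * c')"
    by (subst assoc_mult_mat[of "c * b * g" n n b' n c' n]) (use carr assms in auto)
  finally show ?thesis .
qed

section \<open>Degeneration of Schubert cells\<close>

text \<open>
  In the rows \<open>u j\<close>, \<open>u k\<close> and the columns \<open>j\<close>, \<open>k\<close>, the matrix of \<open>u\<close> is the identity of size two. Put \<open>s\<close> into
  its lower left corner. For \<open>s \<noteq> 0\<close> one row operation and one column operation allowed in \<open>B\<close> turn
  the result into an antidiagonal matrix with entries \<open>s\<close> and \<open>- 1 / s\<close>, that is, into the matrix of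
  \<open>u \<circ> transpose j k\<close> up to a diagonal factor. At \<open>s = 0\<close> the line meets the cell of \<open>u\<close>.
\<close>
lemma schubert_cell_swap:
  fixes F :: "'a::field_char_0 mat set set"
  assumes F: "zariski_closed n F" and u: "u permutes {1..n}"
    and jk: "1 \<le> j" "j < k" "k \<le> n" "u j < u k"
    and cell: "schubert_cell n (u \<circ> transpose j k) \<subseteq> F"
  shows "schubert_cell n u \<subseteq> F"
proof -
  let ?u = "u \<circ> transpose j k"
  obtain P where P: "P \<subseteq> poly_funs n"
    "{g \<in> carrier (GL n). mod_Borel n g \<in> F} = {g \<in> carrier (GL n). \<forall>f\<in>P. f g = 0}"
    using F unfolding zariski_closed_def by blast
  have u': "?u permutes {1..n}"
    using jk by (intro permutes_compose[OF permutes_swap_id u]) auto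
  have uj: "1 \<le> u j" "u j \<le> n" "1 \<le> u k" "u k \<le> n"
    using permutes_in_image[OF u, of j] permutes_in_image[OF u, of k] jk by auto
  define a b x y where "a = j - 1" "b = k - 1" "x = u j - 1" "y = u k - 1"
  then have ab: "a < b" "b < n" "x < y" "y < n" "j = Suc a" "k = Suc b" "u j = Suc x" "u k = Suc y"
    using jk uj by auto
  define E :: "'a mat" where "E = mat n n (\<lambda>(i, l). if i = y \<and> l = a then 1 else 0)"
  have Ec: "E \<in> carrier_mat n n" by (simp add: E_def)
  have curve: "\<exists>U\<in>Borel n. \<exists>V\<in>Borel n. perm_matrix n u + s \<cdot>\<^sub>m E = U * perm_matrix n ?u * V"
    if s: "s \<noteq> 0" for s :: 'a
  proof -
    let ?A1 = "multcol a s (perm_matrix n ?u)"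
    let ?A2 = "multcol b (- 1 / s) ?A1"
    let ?A3 = "addcol (1 / s) b a ?A2"
    let ?A4 = "addrow (1 / s) x y ?A3"
    have u_vals: "u (Suc a) = Suc x" "u (Suc b) = Suc y" using ab by auto
    have u_other: "u (Suc l) \<noteq> Suc x" "u (Suc l) \<noteq> Suc y" if "l \<noteq> a" "l \<noteq> b" for l
      using that u_vals permutes_inj[OF u] by (metis injD nat.inject)+
    have "perm_matrix n u + s \<cdot>\<^sub>m E = ?A4"
    proof (rule eq_matI)
      fix i l assume "i < dim_row ?A4" "l < dim_col ?A4"
      then have il: "i < n" "l < n" by auto
      have n: "a < n" "x < n" "a \<noteq> b" "x \<noteq> y" using ab by auto
      consider "l = a" | "l = b" | "l \<noteq> a" "l \<noteq> b" by blast
      then show "(perm_matrix n u + s \<cdot>\<^sub>m E) $$ (i, l) = ?A4 $$ (i, l)"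
        using ab(2,4) n il s
        by cases (simp_all add: perm_matrix_entry E_def transpose_def ab(5,6) u_vals u_other)
    qed (auto simp: E_def)
    moreover have "?A4 = addrow_mat n (1 / s) x y * perm_matrix n ?u *
        (multrow_mat n a s * multrow_mat n b (- 1 / s) * addrow_mat n (1 / s) a b)"
    proof -
      have c0: "perm_matrix n ?u \<in> carrier_mat n n" by simp
      have A1: "?A1 = perm_matrix n ?u * multrow_mat n a s" by (rule multcol_mat[OF c0])
      have c1: "?A1 \<in> carrier_mat n n" by auto
      have A2: "?A2 = ?A1 * multrow_mat n b (- 1 / s)" by (rule multcol_mat[OF c1])
      have c2: "?A2 \<in> carrier_mat n n" by auto
      have A3: "?A3 = ?A2 * addrow_mat n (1 / s) a b" by (rule addcol_mat[OF c2]) (use ab in auto)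
      have c3: "?A3 \<in> carrier_mat n n" by auto
      have A4: "?A4 = addrow_mat n (1 / s) x y * ?A3" by (rule addrow_mat[OF c3]) (use ab in auto)
      let ?U = "addrow_mat n (1 / s) x y" and ?V1 = "multrow_mat n a s"
        and ?V2 = "multrow_mat n b (- 1 / s)" and ?V3 = "addrow_mat n (1 / s) a b"
      have D: "multrow_mat n a s \<in> carrier_mat n n" "multrow_mat n b (- 1 / s) \<in> carrier_mat n n"
        "addrow_mat n (1 / s) a b \<in> carrier_mat n n" "addrow_mat n (1 / s) x y \<in> carrier_mat n n"
        by auto
      show ?thesis
      proof -
        have "?A4 = ?U * (perm_matrix n ?u * ?V1 * ?V2 * ?V3)" by (subst A4, subst A3, subst A2, subst A1) (rule refl)
        also have "perm_matrix n ?u * ?V1 * ?V2 = perm_matrix n ?u * (?V1 * ?V2)"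
          by (rule assoc_mult_mat[of _ n n _ n _ n]) (use c0 D in auto)
        also have "\<dots> * ?V3 = perm_matrix n ?u * (?V1 * ?V2 * ?V3)"
          by (rule assoc_mult_mat[of _ n n _ n _ n]) (use c0 D in auto)
        also have "?U * \<dots> = ?U * perm_matrix n ?u * (?V1 * ?V2 * ?V3)"
          by (rule assoc_mult_mat[of _ n n _ n _ n, symmetric]) (use c0 D in auto)
        finally show ?thesis .
      qed
    qed
    moreover have "addrow_mat n (1 / s) x y \<in> Borel n"
      "multrow_mat n a s * multrow_mat n b (- 1 / s) * addrow_mat n (1 / s) a b \<in> Borel n"
      using ab s by (auto intro!: Borel_mult multrow_mat_Borel addrow_mat_Borel)
    ultimately show ?thesis by metis
  qed
  show ?thesis
    unfolding schubert_cell_def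
  proof (rule image_subsetI)
    fix c :: "'a mat" assume c: "c \<in> Borel n"
    then have cc: "c \<in> carrier_mat n n" by (rule Borel_carrier)
    have GL: "c * perm_matrix n u \<in> carrier (GL n)"
      using c perm_matrix_GL[OF u, where 'a='a] by (auto simp: Borel_def intro: GL_mult)
    have "f (c * perm_matrix n u) = 0" if f: "f \<in> P" for f
    proof -
      let ?M = "c * perm_matrix n u" and ?N = "c * E"
      have "f (?M + s \<cdot>\<^sub>m ?N) = 0" if s: "s \<notin> {0}" for s
      proof -
        obtain U V where UV: "U \<in> Borel n" "V \<in> Borel n"
          "perm_matrix n u + s \<cdot>\<^sub>m E = U * perm_matrix n ?u * V"
          using curve s by blast
        have "?M + s \<cdot>\<^sub>m ?N = c * (perm_matrix n u + s \<cdot>\<^sub>m E)"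
          using cc Ec mult_add_distrib_mat[of c n n "perm_matrix n u" n "s \<cdot>\<^sub>m E"]
            mult_smult_distrib[of c n n E n s] by simp
        also have "\<dots> = c * (U * perm_matrix n ?u * V) * 1\<^sub>m n"
        proof -
          have "c * (U * perm_matrix n ?u * V) \<in> carrier_mat n n"
            using cc Borel_carrier[OF UV(1)] Borel_carrier[OF UV(2)] by auto
          then show ?thesis unfolding UV(3) by (rule right_mult_one_mat[symmetric])
        qed
        also have "\<dots> = (c * U) * perm_matrix n ?u * (V * 1\<^sub>m n)"
          by (rule Borel_double_coset_mult) (use c UV Borel_one in auto)
        finally have eq: "?M + s \<cdot>\<^sub>m ?N = (c * U) * perm_matrix n ?u * (V * 1\<^sub>m n)" .
        have cU: "c * U \<in> Borel n" "V * 1\<^sub>m n \<in> Borel n"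
          using c UV Borel_mult Borel_one by auto
        have GL': "(c * U) * perm_matrix n ?u * (V * 1\<^sub>m n) \<in> carrier (GL n)"
          using cU perm_matrix_GL[OF u', where 'a='a] by (auto simp: Borel_def intro!: GL_mult)
        have "mod_Borel n ((c * U) * perm_matrix n ?u * (V * 1\<^sub>m n)) =
            mod_Borel n ((c * U) * perm_matrix n ?u)"
          using Borel_carrier[OF cU(1)] by (intro mod_Borel_mult cU(2)) auto
        also have "\<dots> \<in> F"
          using cell cU unfolding schubert_cell_def by blast
        finally show ?thesis using P(2) GL' f eq by auto
      qed
      then have "f (?M + 0 \<cdot>\<^sub>m ?N) = 0"
        by (rule poly_fun_zero_on_line[of _ n _ _ "{0}", rotated 4])
          (use f P cc Ec in auto)
      moreover have "?M \<in> carrier_mat n n" "?N \<in> carrier_mat n n" using cc Ec by auto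
      then have "?M + 0 \<cdot>\<^sub>m ?N = ?M" by (intro eq_matI) auto
      ultimately show ?thesis by simp
    qed
    then show "mod_Borel n (c * perm_matrix n u) \<in> F"
      using P(2) GL by blast
  qed
qed

section \<open>Bruhat decomposition\<close>
lemma sum_two_terms:
  fixes f :: "nat \<Rightarrow> 'a::comm_monoid_add"
  assumes "a < n" "b < n" "a \<noteq> b" "\<And>z. z < n \<Longrightarrow> z \<noteq> a \<Longrightarrow> z \<noteq> b \<Longrightarrow> f z = 0"
  shows "(\<Sum>z<n. f z) = f a + f b"
proof -
  have "(\<Sum>z<n. f z) = (\<Sum>z\<in>{a, b}. f z)"
    by (rule sum.mono_neutral_right) (use assms in auto)
  then show ?thesis using assms by simp
qed

lemma Borel_clear_column:
  fixes A :: "'a::field mat"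
  assumes A: "A \<in> carrier_mat n n" and i: "i < n" and k: "k < n" and pivot: "A $$ (i, k) \<noteq> 0"
    and below: "\<And>x. i < x \<Longrightarrow> x < n \<Longrightarrow> A $$ (x, k) = 0"
  obtains U where "U \<in> Borel n"
    "\<And>x y. x < n \<Longrightarrow> y < n \<Longrightarrow> (U * A) $$ (x, y) =
       (if x = i then A $$ (i, y) / A $$ (i, k) else A $$ (x, y) - A $$ (x, k) / A $$ (i, k) * A $$ (i, y))"
proof -
  define U where "U = mat n n (\<lambda>(x, y). if y = i then (if x = i then 1 / A $$ (i, k)
     else - A $$ (x, k) / A $$ (i, k)) else if x = y then 1 else (0 :: 'a))"
  have Uc: "U \<in> carrier_mat n n" by (simp add: U_def)
  have ut: "upper_triangular U" using below i by (auto simp: U_def upper_triangular_def)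
  have "0 \<notin> set (diag_mat U)" using pivot by (auto simp: U_def diag_mat_def)
  then have "det U \<noteq> 0" by (simp add: det_upper_triangular[OF ut Uc] prod_list_zero_iff)
  then have "U \<in> Borel n" using Uc ut by (simp add: Borel_iff)
  moreover have "(U * A) $$ (x, y) =
       (if x = i then A $$ (i, y) / A $$ (i, k) else A $$ (x, y) - A $$ (x, k) / A $$ (i, k) * A $$ (i, y))"
    if "x < n" "y < n" for x y
  proof -
    have "(U * A) $$ (x, y) = (\<Sum>z<n. U $$ (x, z) * A $$ (z, y))"
      by (rule mat_mult_entry[where n=n and m=n and p=n]) (use A Uc that in auto)
    also have "\<dots> = (if x = i then A $$ (i, y) / A $$ (i, k)
        else A $$ (x, y) - A $$ (x, k) / A $$ (i, k) * A $$ (i, y))"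
    proof (cases "x = i")
      case True
      then have "(\<Sum>z<n. U $$ (x, z) * A $$ (z, y)) = (\<Sum>z<n. if z = i then A $$ (i, y) / A $$ (i, k) else 0)"
        using i by (intro sum.cong) (auto simp: U_def)
      then show ?thesis using True i by simp
    next
      case False
      have "(\<Sum>z<n. U $$ (x, z) * A $$ (z, y)) = U $$ (x, x) * A $$ (x, y) + U $$ (x, i) * A $$ (i, y)"
        by (rule sum_two_terms) (use that i False in \<open>auto simp: U_def\<close>)
      then show ?thesis using False that i by (simp add: U_def)
    qed
    finally show ?thesis .
  qed
  ultimately show ?thesis using that by blast
qed

lemma Borel_clear_row:
  fixes A :: "'a::field mat"
  assumes A: "A \<in> carrier_mat n n" and i: "i < n" and k: "k < n"
  obtains V where "V \<in> Borel n"
    "\<And>x y. x < n \<Longrightarrow> y < n \<Longrightarrow> (A * V) $$ (x, y) =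
       (if k < y then A $$ (x, y) - A $$ (x, k) * A $$ (i, y) else A $$ (x, y))"
proof -
  define V where "V = mat n n (\<lambda>(x, y). if x = y then 1 else if x = k \<and> k < y then - A $$ (i, y) else (0 :: 'a))"
  have Vc: "V \<in> carrier_mat n n" by (simp add: V_def)
  have ut: "upper_triangular V" by (auto simp: V_def upper_triangular_def)
  have "0 \<notin> set (diag_mat V)" by (auto simp: V_def diag_mat_def)
  then have "det V \<noteq> 0" by (simp add: det_upper_triangular[OF ut Vc] prod_list_zero_iff)
  then have "V \<in> Borel n" using Vc ut by (simp add: Borel_iff)
  moreover have "(A * V) $$ (x, y) =
       (if k < y then A $$ (x, y) - A $$ (x, k) * A $$ (i, y) else A $$ (x, y))"
    if "x < n" "y < n" for x y
  proof -
    have "(A * V) $$ (x, y) = (\<Sum>z<n. A $$ (x, z) * V $$ (z, y))"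
      by (rule mat_mult_entry[where n=n and m=n and p=n]) (use A Vc that in auto)
    also have "\<dots> = (if k < y then A $$ (x, y) - A $$ (x, k) * A $$ (i, y) else A $$ (x, y))"
    proof (cases "k < y")
      case False
      then have "(\<Sum>z<n. A $$ (x, z) * V $$ (z, y)) = (\<Sum>z<n. if z = y then A $$ (x, y) else 0)"
        using that by (intro sum.cong) (auto simp: V_def)
      then show ?thesis using False that by simp
    next
      case True
      have "(\<Sum>z<n. A $$ (x, z) * V $$ (z, y)) = A $$ (x, y) * V $$ (y, y) + A $$ (x, k) * V $$ (k, y)"
        by (rule sum_two_terms) (use that k True in \<open>auto simp: V_def\<close>)
      then show ?thesis using True that k by (simp add: V_def)
    qed
    finally show ?thesis .
  qed
  ultimately show ?thesis using that by blast
qed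

text \<open>
  The first \<open>k\<close> columns are finished: column \<open>l\<close> is the unit vector at its pivot \<open>p l\<close>, and the row of the pivot has
  no other nonzero entry, not even further to the right.
\<close>
definition pivots :: "nat \<Rightarrow> nat \<Rightarrow> (nat \<Rightarrow> nat) \<Rightarrow> 'a::field mat \<Rightarrow> bool" where
  "pivots n k p A \<longleftrightarrow> (\<forall>l<k. p l < n \<and> (\<forall>x<n. A $$ (x, l) = (if x = p l then 1 else 0)) \<and>
     (\<forall>y<n. y \<noteq> l \<longrightarrow> A $$ (p l, y) = 0))"

text \<open>
  The pivot of the new column must be its lowest nonzero entry, because \<open>B\<close> adds only lower rows to
  upper rows. The rows of the earlier pivots vanish in the new column, so clearing does not disturb them.
\<close>
lemma pivots_step:
  fixes A :: "'a::field mat"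
  assumes A: "A \<in> carrier (GL n)" and k: "k < n" and piv: "pivots n k p A"
  shows "\<exists>U\<in>Borel n. \<exists>V\<in>Borel n. \<exists>p'. pivots n (Suc k) p' (U * A * V)"
proof -
  have Ac: "A \<in> carrier_mat n n" using A by (simp add: GL_iff_det)
  obtain B where B: "B \<in> carrier_mat n n" "B * A = 1\<^sub>m n" using GL_inverse[OF A] by blast
  have "\<exists>x<n. A $$ (x, k) \<noteq> 0"
  proof (rule ccontr)
    assume "\<not> (\<exists>x<n. A $$ (x, k) \<noteq> 0)"
    then have "(\<Sum>z<n. B $$ (k, z) * A $$ (z, k)) = 0" by (intro sum.neutral) auto
    then have "(B * A) $$ (k, k) = 0"
      using mat_mult_entry[OF B(1) Ac k k] by simp
    then show False using B(2) k by simp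
  qed
  define i where "i = Max {x. x < n \<and> A $$ (x, k) \<noteq> 0}"
  have "i \<in> {x. x < n \<and> A $$ (x, k) \<noteq> 0}"
    unfolding i_def by (rule Max_in) (use \<open>\<exists>x<n. A $$ (x, k) \<noteq> 0\<close> in auto)
  then have i: "i < n" "A $$ (i, k) \<noteq> 0" by auto
  have below: "A $$ (x, k) = 0" if "i < x" "x < n" for x
  proof (rule ccontr)
    assume "A $$ (x, k) \<noteq> 0"
    then have "x \<le> i" unfolding i_def using that by (intro Max_ge) auto
    then show False using that by simp
  qed
  obtain U where U: "U \<in> Borel n" "\<And>x y. x < n \<Longrightarrow> y < n \<Longrightarrow> (U * A) $$ (x, y) =
       (if x = i then A $$ (i, y) / A $$ (i, k) else A $$ (x, y) - A $$ (x, k) / A $$ (i, k) * A $$ (i, y))"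
    using Borel_clear_column[OF Ac i(1) k i(2) below] by blast
  let ?A1 = "U * A"
  have A1c: "?A1 \<in> carrier_mat n n" using Ac Borel_carrier[OF U(1)] by auto
  obtain V where V: "V \<in> Borel n" "\<And>x y. x < n \<Longrightarrow> y < n \<Longrightarrow> (?A1 * V) $$ (x, y) =
       (if k < y then ?A1 $$ (x, y) - ?A1 $$ (x, k) * ?A1 $$ (i, y) else ?A1 $$ (x, y))"
    using Borel_clear_row[OF A1c i(1) k] by blast
  have p: "p l < n" "\<And>x. x < n \<Longrightarrow> A $$ (x, l) = (if x = p l then 1 else 0)"
    "\<And>y. y < n \<Longrightarrow> y \<noteq> l \<Longrightarrow> A $$ (p l, y) = 0" if "l < k" for l
    using piv that by (auto simp: pivots_def)
  have pi: "p l \<noteq> i" if "l < k" for l using p(3)[OF that k] that i by auto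
  have Ai: "A $$ (i, l) = 0" if "l < k" for l using p(2)[OF that i(1)] pi[OF that] by simp
  have A1: "?A1 $$ (x, l) = A $$ (x, l)" if "l < k" "x < n" for x l
    using U(2)[of x l] Ai[of l] that k by auto
  have A1k: "?A1 $$ (x, k) = (if x = i then 1 else 0)" if "x < n" for x
    using U(2)[OF that k] i by simp
  have A1p: "?A1 $$ (p l, y) = A $$ (p l, y)" if "l < k" "y < n" for l y
    using U(2)[OF p(1)[OF that(1)] that(2)] pi[OF that(1)] p(3)[OF that(1) k] that k by simp
  have "pivots n (Suc k) (p(k := i)) (U * A * V)"
    unfolding pivots_def
  proof (intro allI impI)
    fix l assume "l < Suc k"
    then consider "l < k" | "l = k" by linarith
    then show "(p(k := i)) l < n \<and>
        (\<forall>x<n. (U * A * V) $$ (x, l) = (if x = (p(k := i)) l then 1 else 0)) \<and>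
        (\<forall>y<n. y \<noteq> l \<longrightarrow> (U * A * V) $$ ((p(k := i)) l, y) = 0)"
    proof cases
      case 1
      then have ln: "l < n" using k by simp
      have "(U * A * V) $$ (x, l) = (if x = p l then 1 else 0)" if "x < n" for x
        using V(2)[OF that ln] A1[OF 1 that] p(2)[OF 1 that] 1 by simp
      moreover have "(U * A * V) $$ (p l, y) = 0" if "y < n" "y \<noteq> l" for y
        using V(2)[OF p(1)[OF 1] that(1)] A1p[OF 1 that(1)] A1k[OF p(1)[OF 1]] p(3)[OF 1 that] pi[OF 1]
        by simp
      ultimately show ?thesis using 1 p(1) by simp
    next
      case 2
      have "(U * A * V) $$ (x, k) = (if x = i then 1 else 0)" if "x < n" for x
        using V(2)[OF that k] A1k[OF that] by simp
      moreover have "(U * A * V) $$ (i, y) = 0" if "y < n" "y \<noteq> k" for y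
      proof (cases "k < y")
        case True
        then show ?thesis using V(2)[OF i(1) that(1)] A1k[OF i(1)] by simp
      next
        case False
        then have "y < k" using that by simp
        then show ?thesis using V(2)[OF i(1) that(1)] A1[OF \<open>y < k\<close> i(1)] Ai by simp
      qed
      ultimately show ?thesis using 2 i by simp
    qed
  qed
  then show ?thesis using U V by blast
qed

lemma bruhat_decomposition:
  fixes g :: "'a::field mat"
  assumes g: "g \<in> carrier (GL n)"
  obtains c c' w where "c \<in> Borel n" "c' \<in> Borel n" "w permutes {1..n}"
    "g = c * perm_matrix n w * c'"
proof -
  have gc: "g \<in> carrier_mat n n" using g by (simp add: GL_iff_det)
  have "k \<le> n \<Longrightarrow> \<exists>c\<in>Borel n. \<exists>c'\<in>Borel n. \<exists>p. pivots n k p (c * g * c')" for k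
  proof (induction k)
    case 0
    show ?case using Borel_one by (intro bexI[of _ "1\<^sub>m n"]) (auto simp: pivots_def)
  next
    case (Suc k)
    then obtain c c' p where c: "c \<in> Borel n" "c' \<in> Borel n" and p: "pivots n k p (c * g * c')"
      by auto
    have "c * g * c' \<in> carrier (GL n)"
      using c g by (auto simp: Borel_def intro!: GL_mult)
    from pivots_step[OF this _ p] Suc.prems obtain U V p' where
      UV: "U \<in> Borel n" "V \<in> Borel n" "pivots n (Suc k) p' (U * (c * g * c') * V)" by auto
    then have "pivots n (Suc k) p' ((U * c) * g * (c' * V))"
      using Borel_double_coset_mult[OF gc UV(1,2) c] by simp
    then show ?case using Borel_mult[OF UV(1) c(1)] Borel_mult[OF c(2) UV(2)] by blast
  qed
  from this[OF order_refl] obtain c c' p where c: "c \<in> Borel n" "c' \<in> Borel n"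
    and p: "pivots n n p (c * g * c')" by blast
  let ?A = "c * g * c'"
  have Ac: "?A \<in> carrier_mat n n" using c gc Borel_carrier by (metis mult_carrier_mat)
  have inj: "inj_on p {..<n}"
  proof (rule inj_onI, rule ccontr)
    fix l l' assume l: "l \<in> {..<n}" "l' \<in> {..<n}" "p l = p l'" "l \<noteq> l'"
    have "p l' < n" "\<forall>x<n. ?A $$ (x, l') = (if x = p l' then 1 else 0)"
      "\<forall>y<n. y \<noteq> l \<longrightarrow> ?A $$ (p l, y) = 0"
      using p l(1,2) unfolding pivots_def by blast+
    then have "?A $$ (p l', l') = 1" "?A $$ (p l, l') = 0" using l by auto
    then show False using l by simp
  qed
  have range: "p ` {..<n} \<subseteq> {..<n}" using p by (auto simp: pivots_def)
  define w where "w a = (if a \<in> {1..n} then Suc (p (a - 1)) else a)" for a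
  have w: "w permutes {1..n}"
  proof (rule bij_imp_permutes)
    have "inj_on w {1..n}"
    proof (rule inj_onI)
      fix a b assume ab: "a \<in> {1..n}" "b \<in> {1..n}" "w a = w b"
      then have "p (a - 1) = p (b - 1)" by (simp add: w_def)
      moreover have "a - 1 \<in> {..<n}" "b - 1 \<in> {..<n}" using ab by auto
      ultimately have "a - 1 = b - 1" using inj by (auto dest: inj_onD)
      then show "a = b" using ab by auto
    qed
    moreover have "w ` {1..n} \<subseteq> {1..n}"
    proof
      fix y assume "y \<in> w ` {1..n}"
      then obtain a where a: "a \<in> {1..n}" "y = Suc (p (a - 1))" by (auto simp: w_def)
      then have "a - 1 \<in> {..<n}" by auto
      then have "p (a - 1) < n" using range by blast
      then show "y \<in> {1..n}" using a by simp
    qed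
    ultimately show "bij_betw w {1..n} {1..n}"
      unfolding bij_betw_def using endo_inj_surj[of "{1..n}" w] by simp
    show "w x = x" if "x \<notin> {1..n}" for x using that unfolding w_def by (rule if_not_P)
  qed
  have A_perm: "?A = perm_matrix n w"
  proof (rule eq_matI)
    fix x y assume "x < dim_row (perm_matrix n w :: 'a mat)" "y < dim_col (perm_matrix n w :: 'a mat)"
    then show "?A $$ (x, y) = perm_matrix n w $$ (x, y)"
      using p by (auto simp: pivots_def perm_matrix_entry w_def)
  qed (use Ac in auto)
  obtain d d' where d: "d \<in> Borel n" "d * c = 1\<^sub>m n" and d': "d' \<in> Borel n" "c' * d' = 1\<^sub>m n"
    using Borel_inverse[OF c(1)] Borel_inverse[OF c(2)] by metis
  have "d * ?A * d' = (d * c) * g * (c' * d')"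
    by (rule Borel_double_coset_mult) (use gc c d d' in auto)
  then have "g = d * perm_matrix n w * d'" using d d' gc by (simp add: A_perm)
  then show ?thesis using that[OF d(1) d'(1) w] by blast
qed

section \<open>Schubert varieties by rank conditions\<close>

text \<open>
  The rank of the corner with rows from \<open>i\<close> on and the first \<open>l\<close> columns is at most \<open>r\<close>, expressed by a
  factorization through a space of dimension at most \<open>r\<close>. In this form the invariance under \<open>B\<close> on both sides is
  immediate, and rank bounds can be shown by writing down a factorization. The index set is arbitrary,
  so that it can be a set of rows or of columns.
\<close>
definition sw_factors :: "nat \<Rightarrow> nat \<Rightarrow> nat \<Rightarrow> nat \<Rightarrow> 'a::field mat \<Rightarrow> bool" where
  "sw_factors n r i l A \<longleftrightarrow> (\<exists>(S :: nat set) X Y. finite S \<and> card S \<le> r \<and>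
     (\<forall>x\<in>{i..<n}. \<forall>y<l. A $$ (x, y) = (\<Sum>s\<in>S. X x s * Y s y)))"

lemma sw_factors_mult_left:
  assumes A: "A \<in> carrier_mat n n" and c: "c \<in> Borel n" and l: "l \<le> n"
    and fac: "sw_factors n r i l A"
  shows "sw_factors n r i l (c * A)"
proof -
  obtain S :: "nat set" and X Y where S: "finite S" "card S \<le> r"
    and XY: "\<And>x y. i \<le> x \<Longrightarrow> x < n \<Longrightarrow> y < l \<Longrightarrow> A $$ (x, y) = (\<Sum>s\<in>S. X x s * Y s y)"
    using fac unfolding sw_factors_def by auto
  have "(c * A) $$ (x, y) = (\<Sum>s\<in>S. (\<Sum>z<n. c $$ (x, z) * X z s) * Y s y)"
    if "i \<le> x" "x < n" "y < l" for x y
  proof -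
    have "(c * A) $$ (x, y) = (\<Sum>z<n. c $$ (x, z) * A $$ (z, y))"
      by (rule mat_mult_entry[where n=n and m=n and p=n]) (use A Borel_carrier[OF c] that l in auto)
    also have "\<dots> = (\<Sum>z<n. \<Sum>s\<in>S. c $$ (x, z) * X z s * Y s y)"
    proof (rule sum.cong[OF refl])
      fix z assume z: "z \<in> {..<n}"
      show "c $$ (x, z) * A $$ (z, y) = (\<Sum>s\<in>S. c $$ (x, z) * X z s * Y s y)"
      proof (cases "z < x")
        case True
        then have "c $$ (x, z) = 0" using c that by (auto simp: Borel_iff upper_triangular_def)
        then show ?thesis by simp
      next
        case False
        then show ?thesis using XY[of z y] z that by (simp add: sum_distrib_left mult.assoc)
      qed
    qed
    also have "\<dots> = (\<Sum>s\<in>S. (\<Sum>z<n. c $$ (x, z) * X z s) * Y s y)"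
      by (subst sum.swap) (simp add: sum_distrib_right)
    finally show ?thesis .
  qed
  then show ?thesis unfolding sw_factors_def using S
    by (intro exI[of _ S] exI[of _ "\<lambda>x s. \<Sum>z<n. c $$ (x, z) * X z s"] exI[of _ Y]) auto
qed

lemma sw_factors_mult_right:
  assumes A: "A \<in> carrier_mat n n" and c: "c \<in> Borel n" and l: "l \<le> n"
    and fac: "sw_factors n r i l A"
  shows "sw_factors n r i l (A * c)"
proof -
  obtain S :: "nat set" and X Y where S: "finite S" "card S \<le> r"
    and XY: "\<And>x y. i \<le> x \<Longrightarrow> x < n \<Longrightarrow> y < l \<Longrightarrow> A $$ (x, y) = (\<Sum>s\<in>S. X x s * Y s y)"
    using fac unfolding sw_factors_def by auto
  have "(A * c) $$ (x, y) = (\<Sum>s\<in>S. X x s * (\<Sum>z<n. Y s z * c $$ (z, y)))"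
    if "i \<le> x" "x < n" "y < l" for x y
  proof -
    have "(A * c) $$ (x, y) = (\<Sum>z<n. A $$ (x, z) * c $$ (z, y))"
      by (rule mat_mult_entry[where n=n and m=n and p=n]) (use A Borel_carrier[OF c] that l in auto)
    also have "\<dots> = (\<Sum>z<n. \<Sum>s\<in>S. X x s * (Y s z * c $$ (z, y)))"
    proof (rule sum.cong[OF refl])
      fix z assume z: "z \<in> {..<n}"
      show "A $$ (x, z) * c $$ (z, y) = (\<Sum>s\<in>S. X x s * (Y s z * c $$ (z, y)))"
      proof (cases "y < z")
        case True
        then have "c $$ (z, y) = 0" using c that z by (auto simp: Borel_iff upper_triangular_def)
        then show ?thesis by simp
      next
        case False
        then show ?thesis using XY[of x z] z that by (simp add: sum_distrib_right mult.assoc)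
      qed
    qed
    also have "\<dots> = (\<Sum>s\<in>S. X x s * (\<Sum>z<n. Y s z * c $$ (z, y)))"
      by (subst sum.swap) (simp add: sum_distrib_left)
    finally show ?thesis .
  qed
  then show ?thesis unfolding sw_factors_def using S
    by (intro exI[of _ S] exI[of _ X] exI[of _ "\<lambda>s y. \<Sum>z<n. Y s z * c $$ (z, y)"]) auto
qed

lemma sw_factors_Borel:
  assumes "A \<in> carrier_mat n n" "c \<in> Borel n" "c' \<in> Borel n" "l \<le> n" "sw_factors n r i l A"
  shows "sw_factors n r i l (c * A * c')"
  using assms Borel_carrier by (metis mult_carrier_mat sw_factors_mult_left sw_factors_mult_right)

lemma sw_factors_mono:
  "sw_factors n r i l A \<Longrightarrow> r \<le> r' \<Longrightarrow> sw_factors n r' i l A"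
  unfolding sw_factors_def by (meson le_trans)

text \<open>Padding the two factors with zeros to square matrices makes the determinant of each of them zero.\<close>
lemma det_low_rank_eq_0:
  fixes X Y :: "nat \<Rightarrow> nat \<Rightarrow> 'a::field"
  assumes S: "finite S" "card S < k"
  shows "det (mat k k (\<lambda>(a, b). \<Sum>s\<in>S. X a s * Y s b)) = 0"
proof -
  obtain f where f: "bij_betw f {0..<card S} S"
    using ex_bij_betw_nat_finite[OF S(1)] by blast
  define q where "q = card S"
  define X' where "X' = mat k k (\<lambda>(a, t). if t < q then X a (f t) else 0)"
  define Y' where "Y' = mat k k (\<lambda>(t, b). if t < q then Y (f t) b else 0)"
  have c: "X' \<in> carrier_mat k k" "Y' \<in> carrier_mat k k" by (auto simp: X'_def Y'_def)
  have "mat k k (\<lambda>(a, b). \<Sum>s\<in>S. X a s * Y s b) = X' * Y'"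
  proof (rule eq_matI)
    fix a b assume "a < dim_row (X' * Y')" "b < dim_col (X' * Y')"
    then have ab: "a < k" "b < k" using c by auto
    have "(X' * Y') $$ (a, b) = (\<Sum>t<k. X' $$ (a, t) * Y' $$ (t, b))"
      by (rule mat_mult_entry) (use c ab in auto)
    also have "\<dots> = (\<Sum>t<q. X a (f t) * Y (f t) b)"
      using S ab by (intro sum.mono_neutral_cong_right) (auto simp: X'_def Y'_def q_def)
    also have "\<dots> = (\<Sum>s\<in>S. X a s * Y s b)"
      using f by (intro sum.reindex_bij_betw) (simp add: q_def lessThan_atLeast0)
    finally show "mat k k (\<lambda>(a, b). \<Sum>s\<in>S. X a s * Y s b) $$ (a, b) = (X' * Y') $$ (a, b)"
      using ab by simp
  qed (use c in auto)
  moreover have "X' *\<^sub>v unit_vec k q = 0\<^sub>v k"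
    using S c by (intro eq_vecI) (auto simp: X'_def q_def)
  then have "det X' = 0"
    using det_0_iff_vec_prod_zero_field[OF c(1)] S
    by (auto simp: q_def intro!: exI[of _ "unit_vec k (card S)"])
  ultimately show ?thesis using det_mult[OF c] by simp
qed

lemma sw_factors_minor_eq_0:
  assumes fac: "sw_factors n r i l A" and k: "r < k"
    and R: "\<And>a. a < k \<Longrightarrow> i \<le> R a \<and> R a < n" and C: "\<And>b. b < k \<Longrightarrow> C b < l"
  shows "minor k R C A = 0"
proof -
  obtain S :: "nat set" and X Y where S: "finite S" "card S \<le> r"
    and XY: "\<And>x y. i \<le> x \<Longrightarrow> x < n \<Longrightarrow> y < l \<Longrightarrow> A $$ (x, y) = (\<Sum>s\<in>S. X x s * Y s y)"
    using fac unfolding sw_factors_def by auto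
  have "mat k k (\<lambda>(a, b). A $$ (R a, C b)) = mat k k (\<lambda>(a, b). \<Sum>s\<in>S. X (R a) s * Y s (C b))"
    by (rule cong_mat) (use XY R C in auto)
  then show ?thesis
    using det_low_rank_eq_0[of S k "\<lambda>a s. X (R a) s" "\<lambda>s b. Y s (C b)"] S k
    by (simp add: minor_def)
qed

lemma sw_factors_perm_matrix:
  assumes "l \<le> n"
  shows "sw_factors n (sw_rank w i l) i l (perm_matrix n w)"
  unfolding sw_factors_def
proof (intro exI conjI ballI allI impI)
  let ?S = "{a \<in> {1..l}. i < w a}"
  show "finite ?S" "card ?S \<le> sw_rank w i l" by (auto simp: sw_rank_def)
  fix x y assume xy: "x \<in> {i..<n}" "y < l"
  have "(\<Sum>s\<in>?S. (if w s = Suc x then 1 else 0) * (if s = Suc y then 1 else 0)) =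
      (\<Sum>s\<in>?S. if s = Suc y then (if w (Suc y) = Suc x then 1 else 0) else (0::'a))"
    by (rule sum.cong) auto
  also have "\<dots> = (if w (Suc y) = Suc x then 1 else 0)"
    using xy by (subst sum.delta) auto
  finally show "perm_matrix n w $$ (x, y) =
      (\<Sum>s\<in>?S. (if w s = Suc x then 1 else 0) * (if s = Suc y then 1 else 0) :: 'a)"
    using xy assms by (simp add: perm_matrix_entry)
qed

lemma perm_matrix_minor_eq_1:
  assumes v: "v permutes {1..n}" and l: "l \<le> n"
  obtains R C where "\<And>a. a < sw_rank v i l \<Longrightarrow> i \<le> R a \<and> R a < n" "\<And>a. a < sw_rank v i l \<Longrightarrow> C a < l"
    "minor (sw_rank v i l) R C (perm_matrix n v :: 'a::field mat) = 1"
proof -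
  let ?S = "{a \<in> {1..l}. i < v a}" and ?q = "sw_rank v i l"
  obtain f where f: "bij_betw f {0..<?q} ?S"
    using ex_bij_betw_nat_finite[of ?S] by (auto simp: sw_rank_def)
  have fS: "f a \<in> ?S" if "a < ?q" for a using f that by (auto simp: bij_betw_def)
  define R where "R a = v (f a) - 1" for a
  define C where "C a = f a - 1" for a
  have vf: "v (f a) \<in> {1..n}" if "a < ?q" for a
    using permutes_in_image[OF v, of "f a"] fS[OF that] l by auto
  have RC: "i \<le> R a \<and> R a < n" "C a < l" if "a < ?q" for a
    using fS[OF that] vf[OF that] by (auto simp: R_def C_def)
  have "mat ?q ?q (\<lambda>(a, b). perm_matrix n v $$ (R a, C b)) = (1\<^sub>m ?q :: 'a mat)"
  proof (rule eq_matI)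
    fix a b assume "a < dim_row (1\<^sub>m ?q :: 'a mat)" "b < dim_col (1\<^sub>m ?q :: 'a mat)"
    then have ab: "a < ?q" "b < ?q" by auto
    have "Suc (C b) = f b" "Suc (R a) = v (f a)"
      using fS[OF ab(2)] vf[OF ab(1)] by (auto simp: R_def C_def)
    moreover have "v (f b) = v (f a) \<longleftrightarrow> a = b"
      using permutes_inj[OF v] f ab by (auto simp: bij_betw_def dest!: injD inj_onD)
    ultimately show "mat ?q ?q (\<lambda>(a, b). perm_matrix n v $$ (R a, C b)) $$ (a, b) = (1\<^sub>m ?q :: 'a mat) $$ (a, b)"
      using ab RC(1)[OF ab(1)] RC(2)[OF ab(2)] l by (simp add: perm_matrix_entry)
  qed auto
  then have "minor ?q R C (perm_matrix n v :: 'a mat) = 1" by (simp add: minor_def)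
  then show ?thesis using that RC by blast
qed

text \<open>The corner ranks of \<open>g\<close> are invariants of its double coset, hence bounded below by those of \<open>v\<close>.\<close>
lemma sw_rank_le_of_sw_factors:
  fixes g :: "'a::field mat"
  assumes v: "v permutes {1..n}" and l: "l \<le> n" and c: "c \<in> Borel n" "c' \<in> Borel n"
    and g: "g = c * perm_matrix n v * c'" and fac: "sw_factors n r i l g"
  shows "sw_rank v i l \<le> r"
proof (rule ccontr)
  assume "\<not> sw_rank v i l \<le> r"
  obtain d d' where d: "d \<in> Borel n" "d * c = 1\<^sub>m n" and d': "d' \<in> Borel n" "c' * d' = 1\<^sub>m n"
    using Borel_inverse[OF c(1)] Borel_inverse[OF c(2)] by metis
  have gc: "g \<in> carrier_mat n n"
    unfolding g using Borel_carrier[OF c(1)] Borel_carrier[OF c(2)] by auto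
  have "d * g * d' = (d * c) * perm_matrix n v * (c' * d')"
    unfolding g by (rule Borel_double_coset_mult) (use c d d' in auto)
  then have "perm_matrix n v = d * g * d'" using d d' by simp
  then have fac': "sw_factors n r i l (perm_matrix n v :: 'a mat)"
    using sw_factors_Borel[OF gc d(1) d'(1) l fac] by simp
  obtain R C where RC: "\<And>a. a < sw_rank v i l \<Longrightarrow> i \<le> R a \<and> R a < n"
    "\<And>a. a < sw_rank v i l \<Longrightarrow> C a < l"
    and m: "minor (sw_rank v i l) R C (perm_matrix n v :: 'a mat) = 1"
    using perm_matrix_minor_eq_1[OF v l] by blast
  have "minor (sw_rank v i l) R C (perm_matrix n v :: 'a mat) = 0"
    by (rule sw_factors_minor_eq_0[OF fac' _ RC]) (use \<open>\<not> sw_rank v i l \<le> r\<close> in auto)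
  then show False using m by simp
qed

text \<open>The minors vanish on the cell, and imposing them with all their translates is a closed condition.\<close>
lemma schubert_variety_minor_eq_0:
  fixes g :: "'a::field mat"
  assumes g: "g \<in> carrier (GL n)" and mem: "mod_Borel n g \<in> schubert_variety n w"
    and l: "l \<le> n" and k: "sw_rank w i l < k"
    and R: "\<And>a. a < k \<Longrightarrow> i \<le> R a \<and> R a < n" and C: "\<And>b. b < k \<Longrightarrow> C b < l"
    and c: "c \<in> Borel n" "c' \<in> Borel n" and w: "w permutes {1..n}"
  shows "minor k R C (c * g * c') = 0"
proof -
  let ?Z = "{g \<in> carrier (GL n). \<forall>c\<in>Borel n. \<forall>c'\<in>Borel n. minor k R C (c * g * c') = (0::'a)}"
  have poly: "(minor k R C :: 'a mat \<Rightarrow> 'a) \<in> poly_funs n"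
    using minor_poly_fun[of k R n C] R C l by (meson order_less_le_trans)
  have "schubert_cell n w \<subseteq> mod_Borel n ` ?Z"
    unfolding schubert_cell_def
  proof (intro image_mono image_subsetI)
    fix b :: "'a mat" assume b: "b \<in> Borel n"
    have "b * perm_matrix n w \<in> ?Z"
    proof (intro CollectI conjI ballI)
      show "b * perm_matrix n w \<in> carrier (GL n)"
        using b perm_matrix_GL[OF w, where 'a='a] by (auto simp: Borel_def intro!: GL_mult)
      fix d d' :: "'a mat" assume d: "d \<in> Borel n" "d' \<in> Borel n"
      have "b * perm_matrix n w * 1\<^sub>m n = b * perm_matrix n w"
        using Borel_carrier[OF b] by (intro right_mult_one_mat) auto
      moreover have "sw_factors n (sw_rank w i l) i l (b * perm_matrix n w * 1\<^sub>m n)"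
        by (rule sw_factors_Borel[OF _ b Borel_one l sw_factors_perm_matrix[OF l]]) simp
      ultimately have "sw_factors n (sw_rank w i l) i l (b * perm_matrix n w)" by simp
      then have "sw_factors n (sw_rank w i l) i l (d * (b * perm_matrix n w) * d')"
        using Borel_carrier[OF b] d l by (intro sw_factors_Borel) auto
      then show "minor k R C (d * (b * perm_matrix n w) * d') = 0"
        by (rule sw_factors_minor_eq_0[OF _ k R C])
    qed
    then show "mod_Borel n (b * perm_matrix n w) \<in> mod_Borel n ` ?Z" by blast
  qed
  then have "mod_Borel n g \<in> mod_Borel n ` ?Z"
    using mem zariski_closed_translates(1)[OF poly]
    by (auto simp: schubert_variety_def hull_def)
  then have "g \<in> ?Z"
    using zariski_closed_translates(2)[OF poly g] by simp
  then show ?thesis using c by blast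
qed

text \<open>
  Let \<open>v\<close> be the permutation of the double coset of \<open>g\<close>. Both sides say that the corner ranks of \<open>v\<close> are at most
  those of \<open>w\<close>. If so, the cell of \<open>v\<close> is reached from that of \<open>w\<close> by a chain of degenerations; if not, some
  minor equals one at \<open>v\<close> and vanishes on the Schubert variety of \<open>w\<close>.
\<close>
lemma schubert_variety_iff_sw_factors:
  fixes g :: "'a::field_char_0 mat"
  assumes g: "g \<in> carrier (GL n)" and w: "w permutes {1..n}"
  shows "mod_Borel n g \<in> schubert_variety n w \<longleftrightarrow>
    (\<forall>i l. l \<le> n \<longrightarrow> sw_factors n (sw_rank w i l) i l g)"
proof -
  obtain c c' v where c: "c \<in> Borel n" "c' \<in> Borel n" and v: "v permutes {1..n}"
    and gv: "g = c * perm_matrix n v * c'"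
    using bruhat_decomposition[OF g] by blast
  have fac: "sw_factors n (sw_rank v i l) i l g" if "l \<le> n" for i l
    unfolding gv using sw_factors_Borel[OF _ c that sw_factors_perm_matrix[OF that]] by simp
  show ?thesis
  proof
    assume mem: "mod_Borel n g \<in> schubert_variety n w"
    obtain d d' where d: "d \<in> Borel n" "d * c = 1\<^sub>m n" and d': "d' \<in> Borel n" "c' * d' = 1\<^sub>m n"
      using Borel_inverse[OF c(1)] Borel_inverse[OF c(2)] by metis
    have "d * g * d' = (d * c) * perm_matrix n v * (c' * d')"
      unfolding gv by (rule Borel_double_coset_mult) (use c d d' in auto)
    then have perm: "d * g * d' = perm_matrix n v" using d d' by simp
    have "sw_rank v i l \<le> sw_rank w i l" if l: "l \<le> n" for i l
    proof (rule ccontr)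
      assume less: "\<not> sw_rank v i l \<le> sw_rank w i l"
      obtain R C where RC: "\<And>a. a < sw_rank v i l \<Longrightarrow> i \<le> R a \<and> R a < n"
        "\<And>a. a < sw_rank v i l \<Longrightarrow> C a < l"
        and m: "minor (sw_rank v i l) R C (perm_matrix n v :: 'a mat) = 1"
        using perm_matrix_minor_eq_1[OF v l] by blast
      have "minor (sw_rank v i l) R C (d * g * d') = 0"
        by (rule schubert_variety_minor_eq_0[OF g mem l _ RC d(1) d'(1) w]) (use less in auto)
      then show False using m perm by simp
    qed
    then show "\<forall>i l. l \<le> n \<longrightarrow> sw_factors n (sw_rank w i l) i l g"
      using fac sw_factors_mono by blast
  next
    assume facs: "\<forall>i l. l \<le> n \<longrightarrow> sw_factors n (sw_rank w i l) i l g"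
    have le: "sw_rank v i l \<le> sw_rank w i l" if "l \<le> n" for i l
      using sw_rank_le_of_sw_factors[OF v that c gv] facs that by blast
    have "mod_Borel n g \<in> F" if F: "zariski_closed n F" "schubert_cell n w \<subseteq> F" for F
    proof -
      have "schubert_cell n v \<subseteq> F"
      proof (rule bruhat_descend[OF v w le, where P = "\<lambda>u. schubert_cell n u \<subseteq> F"])
        show "schubert_cell n w \<subseteq> F" by (rule F(2))
      qed (assumption | rule schubert_cell_swap[OF F(1)])+
      moreover have "mod_Borel n g = mod_Borel n (c * perm_matrix n v)"
        unfolding gv using Borel_carrier[OF c(1)] by (intro mod_Borel_mult c(2)) auto
      ultimately show ?thesis using c(1) by (auto simp: schubert_cell_def)
    qed
    then show "mod_Borel n g \<in> schubert_variety n w"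
      by (auto simp: schubert_variety_def hull_def)
  qed
qed

section \<open>The main affine neighborhood\<close>
lemma lower_unitriangular_eq:
  "lower_unitriangular n = (\<lambda>x. 1\<^sub>m n + x) ` strictly_lower n"
proof (intro equalityI subsetI)
  fix g :: "'a mat" assume g: "g \<in> lower_unitriangular n"
  then have gc: "g \<in> carrier_mat n n" by (simp add: lower_unitriangular_def)
  have "g - 1\<^sub>m n \<in> strictly_lower n"
    using g by (auto simp: strictly_lower_def lower_unitriangular_def le_less)
  moreover have "g = 1\<^sub>m n + (g - 1\<^sub>m n)" by (rule eq_matI) (use gc in auto)
  ultimately show "g \<in> (\<lambda>x. 1\<^sub>m n + x) ` strictly_lower n" by blast
next
  fix g :: "'a mat" assume "g \<in> (\<lambda>x. 1\<^sub>m n + x) ` strictly_lower n"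
  then show "g \<in> lower_unitriangular n"
    by (auto simp: strictly_lower_def lower_unitriangular_def)
qed

lemma strictly_lower_carrier: "x \<in> strictly_lower n \<Longrightarrow> x \<in> carrier_mat n n"
  by (simp add: strictly_lower_def)

lemma one_plus_strictly_lower_GL:
  fixes x :: "'a::field mat"
  assumes "x \<in> strictly_lower n"
  shows "1\<^sub>m n + x \<in> carrier (GL n)"
proof -
  have c: "1\<^sub>m n + x \<in> carrier_mat n n" using assms by (simp add: strictly_lower_def)
  have "det (1\<^sub>m n + x) = prod_list (diag_mat (1\<^sub>m n + x))"
    by (rule det_lower_triangular[OF _ c]) (use assms in \<open>auto simp: strictly_lower_def\<close>)
  also have "\<dots> = 1"
    using assms by (auto simp: prod_list_diag_prod strictly_lower_def intro!: prod.neutral)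
  finally show ?thesis using c by (simp add: GL_iff_det)
qed

text \<open>
  If \<open>1 + y = (1 + x) * b\<close> with \<open>b\<close> upper triangular, then comparing the rows from the top
  downwards shows \<open>b = 1\<close>.
\<close>
lemma Psi_eq:
  fixes x :: "'a::field mat"
  assumes x: "x \<in> strictly_lower n"
  shows "Psi n (mod_Borel n (1\<^sub>m n + x)) = x"
  unfolding Psi_def
proof (rule the_equality)
  show "x \<in> strictly_lower n \<and> mod_Borel n (1\<^sub>m n + x) = mod_Borel n (1\<^sub>m n + x)" using x by simp
  fix y assume "y \<in> strictly_lower n \<and> mod_Borel n (1\<^sub>m n + x) = mod_Borel n (1\<^sub>m n + y)"
  then have y: "y \<in> strictly_lower n" and "mod_Borel n (1\<^sub>m n + y) = mod_Borel n (1\<^sub>m n + x)" by auto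
  then obtain b where b: "b \<in> Borel n" "1\<^sub>m n + y = (1\<^sub>m n + x) * b"
    using mod_Borel_eqD[of n "1\<^sub>m n + y" "1\<^sub>m n + x"] by (auto simp: strictly_lower_def)
  have xc: "x \<in> carrier_mat n n" and yc: "y \<in> carrier_mat n n" and bc: "b \<in> carrier_mat n n"
    using x y b by (auto simp: strictly_lower_def Borel_carrier)
  have "b $$ (i, j) = (if i = j then 1 else 0)" if "i < n" "j < n" for i j
    using that
  proof (induction i arbitrary: j rule: less_induct)
    case (less i)
    show ?case
    proof (cases "j < i")
      case True
      then show ?thesis using b(1) bc less.prems by (auto simp: Borel_iff upper_triangular_def)
    next
      case False
      have "(1\<^sub>m n + y) $$ (i, j) = (\<Sum>z<n. (1\<^sub>m n + x) $$ (i, z) * b $$ (z, j))"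
        unfolding b(2) by (rule mat_mult_entry[where n=n and m=n and p=n]) (use xc bc less.prems in auto)
      also have "\<dots> = (\<Sum>z<n. if z = i then b $$ (i, j) else 0)"
      proof (rule sum.cong[OF refl])
        fix z assume z: "z \<in> {..<n}"
        show "(1\<^sub>m n + x) $$ (i, z) * b $$ (z, j) = (if z = i then b $$ (i, j) else 0)"
        proof (cases z i rule: linorder_cases)
          case less
          then have "b $$ (z, j) = 0" using less.IH[of z j] less.prems z False by simp
          then show ?thesis using less by simp
        qed (use x xc less.prems z in \<open>auto simp: strictly_lower_def\<close>)
      qed
      also have "\<dots> = b $$ (i, j)" using less.prems by simp
      finally have "b $$ (i, j) = (1\<^sub>m n + y) $$ (i, j)" by simp
      also have "\<dots> = (if i = j then 1 else 0)"
        using y less.prems False by (auto simp: strictly_lower_def)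
      finally show ?thesis .
    qed
  qed
  then have "b = 1\<^sub>m n" using bc by (intro eq_matI) auto
  then have eq: "1\<^sub>m n + y = 1\<^sub>m n + x" using b(2) xc by simp
  show "y = x"
  proof (rule eq_matI)
    fix i j assume "i < dim_row x" "j < dim_col x"
    moreover have "(1\<^sub>m n + y) $$ (i, j) = (1\<^sub>m n + x) $$ (i, j)" using eq by simp
    ultimately show "y $$ (i, j) = x $$ (i, j)" using xc yc by auto
  qed (use xc yc in auto)
qed

lemma Y_set_iff:
  fixes x :: "'a::field mat"
  shows "x \<in> Y_set n w \<longleftrightarrow> x \<in> strictly_lower n \<and> mod_Borel n (1\<^sub>m n + x) \<in> schubert_variety n w"
proof
  assume "x \<in> Y_set n w"
  then obtain y :: "'a mat" where "y \<in> strictly_lower n" "mod_Borel n (1\<^sub>m n + y) \<in> schubert_variety n w"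
    "x = Psi n (mod_Borel n (1\<^sub>m n + y))"
    by (auto simp: Y_set_def main_nbhd_def lower_unitriangular_eq)
  then show "x \<in> strictly_lower n \<and> mod_Borel n (1\<^sub>m n + x) \<in> schubert_variety n w"
    by (simp add: Psi_eq)
next
  assume x: "x \<in> strictly_lower n \<and> mod_Borel n (1\<^sub>m n + x) \<in> schubert_variety n w"
  then show "x \<in> Y_set n w"
    unfolding Y_set_def main_nbhd_def lower_unitriangular_eq
    by (intro image_eqI[of _ _ "mod_Borel n (1\<^sub>m n + x)"]) (auto simp: Psi_eq)
qed

lemma smult_strictly_lower: "x \<in> strictly_lower n \<Longrightarrow> t \<cdot>\<^sub>m x \<in> strictly_lower n"
  by (auto simp: strictly_lower_def)

text \<open>
  Scaling \<open>x\<close> keeps the conditions on the corners below the diagonal, which involve \<open>x\<close> alone. They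
  bound the corner ranks of the permutation of \<open>1 + t x\<close> below the diagonal, hence everywhere.
\<close>
lemma cone_if_no_upper_diagram_box:
  assumes w: "w permutes {1..n}" and no_box: "\<And>i l. \<not> upper_diagram_box n w i l"
  shows "is_cone (Y_set n w :: 'a::field_char_0 mat set)"
  unfolding is_cone_def
proof (intro ballI allI)
  fix x :: "'a mat" and t
  assume "x \<in> Y_set n w"
  then have x: "x \<in> strictly_lower n" and mem: "mod_Borel n (1\<^sub>m n + x) \<in> schubert_variety n w"
    by (auto simp: Y_set_iff)
  have xc: "x \<in> carrier_mat n n" using x by (rule strictly_lower_carrier)
  note tx = smult_strictly_lower[OF x, of t]
  let ?g = "1\<^sub>m n + t \<cdot>\<^sub>m x"
  obtain c c' v where c: "c \<in> Borel n" "c' \<in> Borel n" and v: "v permutes {1..n}"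
    and gv: "?g = c * perm_matrix n v * c'"
    using bruhat_decomposition[OF one_plus_strictly_lower_GL[OF tx]] by blast
  have "sw_rank v i l \<le> sw_rank w i l" if l: "l \<le> n" "l \<le> i" for i l
  proof (rule sw_rank_le_of_sw_factors[OF v l(1) c gv])
    have "sw_factors n (sw_rank w i l) i l (1\<^sub>m n + x)"
      using schubert_variety_iff_sw_factors[OF one_plus_strictly_lower_GL[OF x] w] mem l by blast
    then obtain S :: "nat set" and X Y where S: "finite S" "card S \<le> sw_rank w i l"
      and XY: "\<And>a b. i \<le> a \<Longrightarrow> a < n \<Longrightarrow> b < l \<Longrightarrow> (1\<^sub>m n + x) $$ (a, b) = (\<Sum>s\<in>S. X a s * Y s b)"
      unfolding sw_factors_def by auto
    have "?g $$ (a, b) = (\<Sum>s\<in>S. (t * X a s) * Y s b)" if "i \<le> a" "a < n" "b < l" for a b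
      using XY[OF that] that l xc by (simp add: mult.assoc flip: sum_distrib_left)
    then show "sw_factors n (sw_rank w i l) i l ?g"
      unfolding sw_factors_def using S
      by (intro exI[of _ S] exI[of _ "\<lambda>a s. t * X a s"] exI[of _ Y]) auto
  qed
  then have le: "sw_rank v i l \<le> sw_rank w i l" if "l \<le> n" for i l
    using sw_rank_le_if_le_below_diagonal[OF v w no_box _ that] by blast
  have "sw_factors n (sw_rank w i l) i l ?g" if "l \<le> n" for i l
    using sw_factors_Borel[OF perm_matrix_carrier c that sw_factors_perm_matrix[OF that]]
      sw_factors_mono le[OF that] unfolding gv by blast
  then have "mod_Borel n ?g \<in> schubert_variety n w"
    using schubert_variety_iff_sw_factors[OF one_plus_strictly_lower_GL[OF tx] w] by blast
  then show "t \<cdot>\<^sub>m x \<in> Y_set n w" using tx by (simp add: Y_set_iff)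
qed

section \<open>A totally nonnegative product of bidiagonal matrices\<close>

text \<open>
  The entries of the product \<open>L (k - 1) * \<dots> * L 0\<close>, where \<open>L j\<close> has ones on the diagonal and at the \<open>r\<close> places
  \<open>(p + 1, p)\<close> with \<open>j \<le> p < j + r\<close>, and zeros elsewhere. This is the factorization of a totally nonnegative
  matrix along a reduced word of the permutation that exchanges a block of \<open>r\<close> positions with the
  \<open>k\<close> positions after it.
\<close>
fun bidiag_prod :: "nat \<Rightarrow> nat \<Rightarrow> nat \<Rightarrow> nat \<Rightarrow> nat" where
  "bidiag_prod r 0 i l = (if i = l then 1 else 0)"
| "bidiag_prod r (Suc k) i l = bidiag_prod r k i l + (if k < i \<and> i \<le> k + r then bidiag_prod r k (i - 1) l else 0)"

text \<open>
  The absolute values of the entries of the inverse, in which the inverse of \<open>L 0\<close> is the leftmost factor. The inverse of \<open>L j\<close> differs from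
  the identity only in the rows and columns from \<open>j\<close> to \<open>j + r\<close>, where its entries on and below the diagonal are
  \<open>1\<close> up to the sign \<open>(- 1) ^ (i + l)\<close>. These signs are multiplicative, so no cancellation occurs in the product.
\<close>
fun bidiag_inv :: "nat \<Rightarrow> nat \<Rightarrow> nat \<Rightarrow> nat \<Rightarrow> nat" where
  "bidiag_inv r 0 i l = (if i = l then 1 else 0)"
| "bidiag_inv r (Suc k) i l = (if k \<le> l \<and> l \<le> k + r then (\<Sum>m=l..k+r. bidiag_inv r k i m) else bidiag_inv r k i l)"

lemma bidiag_prod_band: "bidiag_prod r k i l \<noteq> 0 \<Longrightarrow> l \<le> i \<and> i \<le> l + k"
proof (induction k arbitrary: i)
  case (Suc k)
  then have "bidiag_prod r k i l \<noteq> 0 \<or> (k < i \<and> bidiag_prod r k (i - 1) l \<noteq> 0)" by (auto split: if_splits)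
  then show ?case using Suc.IH[of i] Suc.IH[of "i - 1"] by auto
qed (auto split: if_splits)

lemma bidiag_prod_diag: "bidiag_prod r k i i = 1"
proof (induction k)
  case (Suc k)
  have "k < i \<Longrightarrow> bidiag_prod r k (i - 1) i = 0" using bidiag_prod_band[of r k "i - 1" i] by fastforce
  then show ?case using Suc by auto
qed simp

lemma bidiag_prod_row: "k + r \<le> i \<Longrightarrow> bidiag_prod r k i l = (if i = l then 1 else 0)"
  by (induction k) auto

lemma bidiag_prod_top: "l < r \<Longrightarrow> bidiag_prod r k (l + k) l = 1"
proof (induction k)
  case (Suc k)
  have "bidiag_prod r k (l + Suc k) l = 0" using bidiag_prod_band[of r k "l + Suc k" l] by fastforce
  then show ?case using Suc by auto
qed simp

lemma bidiag_inv_row: "k + r \<le> i \<Longrightarrow> bidiag_inv r k i l = (if i = l then 1 else 0)"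
proof (induction k arbitrary: l)
  case (Suc k)
  then have "bidiag_inv r k i m = (if i = m then 1 else 0)" for m by auto
  then show ?case using Suc.prems by (auto intro!: sum.neutral)
qed simp

text \<open>
  The order of the factors matters here. A column \<open>l < k\<close> is moved for the first time by the inverse of \<open>L l\<close>, which
  reaches down to the row \<open>l + r\<close>, and the factors applied after that one end at smaller indices. In
  the opposite order a column could be carried on by one factor after another, past the row \<open>l + r\<close>.
\<close>
lemma bidiag_inv_band: "bidiag_inv r k i l \<noteq> 0 \<Longrightarrow> l \<le> i \<and> i \<le> l + r"
proof (induction k arbitrary: l)
  case (Suc k)
  show ?case
  proof (cases "k \<le> l \<and> l \<le> k + r")
    case True
    then obtain m where m: "m \<in> {l..k+r}" "bidiag_inv r k i m \<noteq> 0"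
      using Suc.prems by auto
    show ?thesis
    proof (cases "k + r \<le> i")
      case True2: True
      then have "i = m" using m(2) bidiag_inv_row[OF True2, of m] by (auto split: if_splits)
      then show ?thesis using m(1) True by auto
    next
      case False
      then show ?thesis using Suc.IH[OF m(2)] m(1) True by auto
    qed
  next
    case False
    then have "bidiag_inv r k i l \<noteq> 0" using Suc.prems by (simp split: if_splits)
    then show ?thesis using Suc.IH by simp
  qed
qed (auto split: if_splits)

text \<open>The later factors have no influence on the column \<open>c\<close>.\<close>
lemma bidiag_inv_stable: "c < k \<Longrightarrow> bidiag_inv r k i c = bidiag_inv r (Suc c) i c"
proof (induction k)
  case (Suc k)
  then show ?case by (cases "c = k") auto
qed simp

lemma bidiag_inv_corner:
  assumes "c < k"
  shows "0 < bidiag_inv r k (c + r) c"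
proof -
  have "bidiag_inv r c (c + r) (c + r) = 1" by (simp add: bidiag_inv_row)
  then have "1 \<le> (\<Sum>m=c..c+r. bidiag_inv r c (c + r) m)"
    using member_le_sum[of "c + r" "{c..c+r}" "bidiag_inv r c (c + r)"] by simp
  then show ?thesis using bidiag_inv_stable[OF assms, of r "c + r"] by simp
qed

lemma bidiag_inv_first_col:
  assumes "0 < k" "i \<le> r"
  shows "bidiag_inv r k i 0 = 1"
  using bidiag_inv_stable[OF assms(1), of r i] assms by simp

lemma alternating_sum_delta:
  fixes l t i :: nat
  assumes "l \<le> t"
  shows "(\<Sum>m=l..t. (- 1) ^ (m + l) * (if i = m then 1 else 0)) =
    (if l \<le> i \<and> i \<le> t then (- 1) ^ (i + l) else (0 :: 'a::comm_ring_1))"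
proof -
  have "(\<Sum>m=l..t. (- 1) ^ (m + l) * (if i = m then 1 else 0)) =
      (\<Sum>m=l..t. if m = i then (- 1) ^ (i + l) else (0 :: 'a))"
    by (intro sum.cong) auto
  then show ?thesis by simp
qed

definition bidiag_mat :: "nat \<Rightarrow> nat \<Rightarrow> nat \<Rightarrow> 'a::field mat" where
  "bidiag_mat r k N = mat N N (\<lambda>(i, l). of_nat (bidiag_prod r k i l))"

definition bidiag_inv_mat :: "nat \<Rightarrow> nat \<Rightarrow> nat \<Rightarrow> 'a::field mat" where
  "bidiag_inv_mat r k N = mat N N (\<lambda>(i, l). (- 1) ^ (i + l) * of_nat (bidiag_inv r k i l))"

lemma bidiag_mat_carrier [simp]: "bidiag_mat r k N \<in> carrier_mat N N"
  and bidiag_inv_mat_carrier [simp]: "bidiag_inv_mat r k N \<in> carrier_mat N N"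
  by (simp_all add: bidiag_mat_def bidiag_inv_mat_def)

lemma bidiag_mat_dims [simp]: "dim_row (bidiag_mat r k N) = N" "dim_col (bidiag_mat r k N) = N"
  and bidiag_inv_mat_dims [simp]: "dim_row (bidiag_inv_mat r k N) = N" "dim_col (bidiag_inv_mat r k N) = N"
  by (simp_all add: bidiag_mat_def bidiag_inv_mat_def)

lemma bidiag_inv_mat_Suc:
  assumes "i < N" "l < N" "k + r < N"
  shows "bidiag_inv_mat r (Suc k) N $$ (i, l) = (if k \<le> l \<and> l \<le> k + r
     then (\<Sum>m=l..k+r. (- 1) ^ (m + l) * bidiag_inv_mat r k N $$ (i, m)) else bidiag_inv_mat r k N $$ (i, l))"
proof (cases "k \<le> l \<and> l \<le> k + r")
  case True
  have eq: "(- 1) ^ (i + l) * of_nat (bidiag_inv r k i m) =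
      (- 1) ^ (m + l) * ((- 1) ^ (i + m) * of_nat (bidiag_inv r k i m) :: 'a)" for m
  proof -
    have "(- 1) ^ (m + l) * (- 1) ^ (i + m) = ((- 1) ^ (i + l) * ((- 1) ^ m * (- 1) ^ m) :: 'a)"
      by (simp add: power_add ac_simps)
    also have "(- 1) ^ m * (- 1) ^ m = (1 :: 'a)" by (simp flip: power_mult_distrib)
    finally show ?thesis by (simp flip: mult.assoc)
  qed
  have "bidiag_inv_mat r (Suc k) N $$ (i, l) = (\<Sum>m=l..k+r. (- 1) ^ (i + l) * (of_nat (bidiag_inv r k i m) :: 'a))"
    using True assms by (simp add: bidiag_inv_mat_def sum_distrib_left)
  also have "\<dots> = (\<Sum>m=l..k+r. (- 1) ^ (m + l) * bidiag_inv_mat r k N $$ (i, m))"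
    using assms by (intro sum.cong refl) (simp add: bidiag_inv_mat_def eq)
  finally show ?thesis using True by simp
next
  case False
  then show ?thesis using assms by (auto simp: bidiag_inv_mat_def)
qed

lemma bidiag_mat_Suc:
  assumes "i < N" "l < N"
  shows "bidiag_mat r (Suc k) N $$ (i, l) =
    bidiag_mat r k N $$ (i, l) + (if k < i \<and> i \<le> k + r then bidiag_mat r k N $$ (i - 1, l) else 0)"
  using assms by (auto simp: bidiag_mat_def)

lemma bidiag_mat_inverse_right:
  assumes "k + r \<le> N" "0 < r"
  shows "bidiag_mat r k N * bidiag_inv_mat r k N = (1\<^sub>m N :: 'a::field mat)"
  using assms(1)
proof (induction k)
  case 0
  have "bidiag_mat r 0 N = (1\<^sub>m N :: 'a mat)" by (rule eq_matI) (auto simp: bidiag_mat_def)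
  moreover have "bidiag_inv_mat r 0 N = (1\<^sub>m N :: 'a mat)"
    by (rule eq_matI) (auto simp: bidiag_inv_mat_def power_add simp flip: power_mult_distrib)
  ultimately show ?case by simp
next
  case (Suc k)
  let ?h = "bidiag_mat r k N :: 'a mat" and ?g = "bidiag_inv_mat r k N :: 'a mat"
  let ?h' = "bidiag_mat r (Suc k) N :: 'a mat" and ?g' = "bidiag_inv_mat r (Suc k) N :: 'a mat"
  have IH: "(\<Sum>z<N. ?h $$ (i, z) * ?g $$ (z, l)) = (if i = l then 1 else 0)" if "i < N" "l < N" for i l
    using Suc that mat_mult_entry[of ?h N N ?g N i l] by simp
  have Z: "(\<Sum>z<N. ?h $$ (i, z) * ?g' $$ (z, l)) = (if k \<le> l \<and> l \<le> k + r
      then (if l \<le> i \<and> i \<le> k + r then (- 1) ^ (i + l) else 0) else if i = l then 1 else 0)"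
    if "i < N" "l < N" for i l
  proof (cases "k \<le> l \<and> l \<le> k + r")
    case True
    have "(\<Sum>z<N. ?h $$ (i, z) * ?g' $$ (z, l)) =
        (\<Sum>z<N. \<Sum>m=l..k+r. (- 1) ^ (m + l) * (?h $$ (i, z) * ?g $$ (z, m)))"
      using True that Suc.prems
      by (intro sum.cong) (auto simp: bidiag_inv_mat_Suc sum_distrib_left mult.left_commute)
    also have "\<dots> = (\<Sum>m=l..k+r. (- 1) ^ (m + l) * (\<Sum>z<N. ?h $$ (i, z) * ?g $$ (z, m)))"
      by (subst sum.swap) (simp add: sum_distrib_left)
    also have "\<dots> = (\<Sum>m=l..k+r. (- 1) ^ (m + l) * (if i = m then 1 else 0))"
      using that Suc.prems by (intro sum.cong) (auto simp: IH)
    also have "\<dots> = (if l \<le> i \<and> i \<le> k + r then (- 1) ^ (i + l) else 0)"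
      using True by (intro alternating_sum_delta) simp
    finally show ?thesis using True by simp
  next
    case False
    have "(\<Sum>z<N. ?h $$ (i, z) * ?g' $$ (z, l)) = (\<Sum>z<N. ?h $$ (i, z) * ?g $$ (z, l))"
      using False that Suc.prems by (intro sum.cong) (auto simp: bidiag_inv_mat_Suc)
    also have "\<dots> = (if i = l then 1 else 0)" using IH[OF that] .
    finally show ?thesis using False by auto
  qed
  show ?case
  proof (rule eq_matI)
    fix i l assume "i < dim_row (1\<^sub>m N :: 'a mat)" "l < dim_col (1\<^sub>m N :: 'a mat)"
    then have il: "i < N" "l < N" by auto
    have "(?h' * ?g') $$ (i, l) = (\<Sum>z<N. ?h' $$ (i, z) * ?g' $$ (z, l))"
      by (rule mat_mult_entry) (use il in auto)
    also have "\<dots> = (\<Sum>z<N. ?h $$ (i, z) * ?g' $$ (z, l)) +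
        (if k < i \<and> i \<le> k + r then (\<Sum>z<N. ?h $$ (i - 1, z) * ?g' $$ (z, l)) else 0)"
      using il by (auto simp: bidiag_mat_Suc ring_distribs sum.distrib)
    also have "\<dots> = (if i = l then 1 else 0)"
    proof (cases "k < i \<and> i \<le> k + r")
      case True
      then obtain i' where i': "i = Suc i'" by (cases i) auto
      show ?thesis using Z[OF il] Z[of "i - 1" l] il True i' by auto
    next
      case False
      then show ?thesis using Z[OF il] by auto
    qed
    finally show "(?h' * ?g') $$ (i, l) = 1\<^sub>m N $$ (i, l)" using il by simp
  qed auto
qed

lemma bidiag_mat_inverse_left:
  assumes "k + r \<le> N" "0 < r"
  shows "bidiag_inv_mat r k N * bidiag_mat r k N = (1\<^sub>m N :: 'a::field mat)"
  by (rule mat_mult_left_right_inverse[OF bidiag_mat_carrier bidiag_inv_mat_carrier bidiag_mat_inverse_right[OF assms]])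

text \<open>
  This is the number \<open>\<rho> E \<kappa>\<close> for the last row \<open>\<rho>\<close> and the first column \<open>\<kappa>\<close> of the inverse; by the band structure it
  is the lower left entry of the square of the inverse. All its terms have the sign \<open>(- 1) ^ (d + r)\<close>, and the
  term for \<open>q = d\<close> is nonzero.
\<close>
lemma bidiag_inv_mat_square_corner:
  assumes "0 < d" "d \<le> r" and N: "N = d + r + 1"
  shows "(\<Sum>q=d..r. bidiag_inv_mat r (Suc d) N $$ (d + r, q) * bidiag_inv_mat r (Suc d) N $$ (q, 0)) \<noteq> (0 :: 'a::field_char_0)"
proof -
  let ?e = "Suc d"
  have "bidiag_inv_mat r ?e N $$ (d + r, q) * bidiag_inv_mat r ?e N $$ (q, 0) =
      (- 1) ^ (d + r) * (of_nat (bidiag_inv r ?e (d + r) q * bidiag_inv r ?e q 0) :: 'a)" if "q \<in> {d..r}" for q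
  proof -
    have "(- 1) ^ (d + r + q) * (- 1) ^ q = ((- 1) ^ (d + r) * ((- 1) ^ q * (- 1) ^ q) :: 'a)"
      by (simp add: power_add ac_simps)
    also have "(- 1) ^ q * (- 1) ^ q = (1 :: 'a)" by (simp flip: power_mult_distrib)
    finally have sgn: "(- 1) ^ (d + r + q) * (- 1) ^ q = ((- 1) ^ (d + r) :: 'a)" by simp
    have "bidiag_inv_mat r ?e N $$ (d + r, q) * bidiag_inv_mat r ?e N $$ (q, 0) =
       ((- 1) ^ (d + r + q) * (- 1) ^ q) * (of_nat (bidiag_inv r ?e (d + r) q * bidiag_inv r ?e q 0) :: 'a)"
      using that N by (simp add: bidiag_inv_mat_def)
    then show ?thesis unfolding sgn .
  qed
  then have sum_eq: "(\<Sum>q=d..r. bidiag_inv_mat r ?e N $$ (d + r, q) * bidiag_inv_mat r ?e N $$ (q, 0)) =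
      (- 1) ^ (d + r) * (of_nat (\<Sum>q=d..r. bidiag_inv r ?e (d + r) q * bidiag_inv r ?e q 0) :: 'a)"
    by (simp add: sum_distrib_left del: of_nat_mult)
  have "0 < bidiag_inv r ?e (d + r) d * bidiag_inv r ?e d 0"
    using bidiag_inv_corner[of d ?e r] bidiag_inv_first_col[of ?e d r] assms by (simp del: bidiag_inv.simps)
  moreover have "bidiag_inv r ?e (d + r) d * bidiag_inv r ?e d 0 \<le> (\<Sum>q=d..r. bidiag_inv r ?e (d + r) q * bidiag_inv r ?e q 0)"
    using assms by (intro member_le_sum) auto
  ultimately have "0 < (\<Sum>q=d..r. bidiag_inv r ?e (d + r) q * bidiag_inv r ?e q 0)"
    by (rule order_less_le_trans)
  then have "of_nat (\<Sum>q=d..r. bidiag_inv r ?e (d + r) q * bidiag_inv r ?e q 0) \<noteq> (0 :: 'a)"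
    unfolding of_nat_eq_0_iff by (rule gr_implies_not0)
  then show ?thesis unfolding sum_eq by (simp only: mult_eq_0_iff power_eq_0_iff) simp
qed

declare bidiag_inv.simps(2) [simp del] bidiag_prod.simps(2) [simp del]

lemma mat_vec_entry:
  assumes "A \<in> carrier_mat k m" "v \<in> carrier_vec m" "a < k"
  shows "(A *\<^sub>v v) $ a = (\<Sum>b<m. A $$ (a, b) * v $ b)"
  using assms by (auto simp: scalar_prod_def lessThan_atLeast0 intro!: sum.cong)

lemma bidiag_mat_eq_0: "i < N \<Longrightarrow> l < N \<Longrightarrow> i < l \<or> l + k < i \<Longrightarrow> bidiag_mat r k N $$ (i, l) = 0"
  using bidiag_prod_band[of r k i l] by (cases "bidiag_prod r k i l = 0") (auto simp: bidiag_mat_def)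

lemma bidiag_inv_mat_eq_0: "i < N \<Longrightarrow> l < N \<Longrightarrow> i < l \<or> l + r < i \<Longrightarrow> bidiag_inv_mat r k N $$ (i, l) = 0"
  using bidiag_inv_band[of r k i l] by (cases "bidiag_inv r k i l = 0") (auto simp: bidiag_inv_mat_def)

section \<open>The corner at a diagram box after scaling\<close>

text \<open>
  Let \<open>H + u E\<close> be the matrix in question. The last row \<open>\<rho>\<close> and the first column \<open>\<kappa>\<close> of the inverse
  restrict to null vectors of \<open>H\<close>. A null vector
  of \<open>H + u E\<close> with \<open>u \<noteq> 0\<close> is also annihilated by \<open>\<rho> E\<close>, hence by the matrix obtained when the first row is replaced
  with \<open>\<rho> E\<close>. If \<open>H + u E\<close> is singular for all but finitely many \<open>u\<close>, then so is that matrix, and also at \<open>u = 0\<close>,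
  since its determinant is a polynomial in \<open>u\<close>. But there the
  rows other than the first have rank \<open>r\<close> and determine a null vector up to a multiple of \<open>\<kappa>\<close>, and \<open>\<rho> E \<kappa> \<noteq> 0\<close>.
\<close>
lemma window_nonsingular:
  fixes S :: "'a::field_char_0 set"
  assumes d: "0 < d" "d \<le> r" and N: "N = d + r + 1" and S: "finite S"
    and sing: "\<And>u. u \<notin> S \<Longrightarrow> det (mat (Suc r) (Suc r) (\<lambda>(a, b).
        bidiag_mat r (Suc d) N $$ (d + a, b) + u * (if d + a = b then 1 else 0))) = (0 :: 'a)"
  shows False
proof -
  let ?h = "bidiag_mat r (Suc d) N :: 'a mat" and ?g = "bidiag_inv_mat r (Suc d) N :: 'a mat"
  let ?W = "\<lambda>u. mat (Suc r) (Suc r) (\<lambda>(a, b). ?h $$ (d + a, b) + u * (if d + a = b then 1 else 0))"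
  \<comment> \<open>\<open>T0 + u T1\<close> is \<open>H + u E\<close> with the first row replaced by \<open>\<rho> E\<close>.\<close>
  define T0 where "T0 = mat (Suc r) (Suc r) (\<lambda>(a, b). if a = 0 then (if d \<le> b then ?g $$ (d + r, b) else 0)
      else ?h $$ (d + a, b))"
  define T1 where "T1 = mat (Suc r) (Suc r) (\<lambda>(a, b). if a \<noteq> 0 \<and> d + a = b then 1 else (0 :: 'a))"
  have Tc: "T0 \<in> carrier_mat (Suc r) (Suc r)" "T1 \<in> carrier_mat (Suc r) (Suc r)"
    by (simp_all add: T0_def T1_def)
  have hg: "(\<Sum>z<N. ?h $$ (i, z) * ?g $$ (z, l)) = (if i = l then 1 else 0)" if "i < N" "l < N" for i l
    using bidiag_mat_inverse_right[of "Suc d" r N, where 'a='a] d N that mat_mult_entry[of ?h N N ?g N i l] by simp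
  have gh: "(\<Sum>z<N. ?g $$ (i, z) * ?h $$ (z, l)) = (if i = l then 1 else 0)" if "i < N" "l < N" for i l
    using bidiag_mat_inverse_left[of "Suc d" r N, where 'a='a] d N that mat_mult_entry[of ?g N N ?h N i l] by simp
  have left: "(\<Sum>a<Suc r. ?g $$ (d + r, d + a) * ?h $$ (d + a, b)) = 0" if "b \<le> r" for b
  proof -
    have "(\<Sum>a<Suc r. ?g $$ (d + r, d + a) * ?h $$ (d + a, b)) =
        (\<Sum>z\<in>{d..<N}. ?g $$ (d + r, z) * ?h $$ (z, b))"
      by (rule sum.reindex_bij_witness[of _ "\<lambda>z. z - d" "\<lambda>a. d + a"]) (use N in auto)
    also have "\<dots> = (\<Sum>z<N. ?g $$ (d + r, z) * ?h $$ (z, b))"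
      by (rule sum.mono_neutral_left) (use N in \<open>auto simp: bidiag_inv_mat_eq_0\<close>)
    also have "\<dots> = 0" using gh[of "d + r" b] that d N by simp
    finally show ?thesis .
  qed
  have right: "(\<Sum>b<Suc r. ?h $$ (i, b) * ?g $$ (b, 0)) = 0" if "0 < i" "i < N" for i
  proof -
    have "(\<Sum>b<Suc r. ?h $$ (i, b) * ?g $$ (b, 0)) = (\<Sum>z<N. ?h $$ (i, z) * ?g $$ (z, 0))"
      by (rule sum.mono_neutral_left) (use N in \<open>auto simp: bidiag_inv_mat_eq_0\<close>)
    then show ?thesis using hg[of i 0] that by simp
  qed
  have "det (T0 + u \<cdot>\<^sub>m T1) = 0" if u: "u \<notin> insert 0 S" for u
  proof -
    have Wc: "?W u \<in> carrier_mat (Suc r) (Suc r)" by simp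
    obtain v where v: "v \<in> carrier_vec (Suc r)" "v \<noteq> 0\<^sub>v (Suc r)" "?W u *\<^sub>v v = 0\<^sub>v (Suc r)"
      using det_0_iff_vec_prod_zero_field[OF Wc] sing[of u] u by blast
    have Wv: "(\<Sum>b<Suc r. (?h $$ (d + a, b) + u * (if d + a = b then 1 else 0)) * v $ b) = 0"
      if "a < Suc r" for a
      using mat_vec_entry[OF Wc v(1) that] v(3) that by simp
    have "0 = (\<Sum>a<Suc r. ?g $$ (d + r, d + a) *
        (\<Sum>b<Suc r. (?h $$ (d + a, b) + u * (if d + a = b then 1 else 0)) * v $ b))"
      using Wv by (simp del: sum.lessThan_Suc)
    also have "\<dots> = (\<Sum>a<Suc r. \<Sum>b<Suc r. ?g $$ (d + r, d + a) * ?h $$ (d + a, b) * v $ b +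
        u * (if d + a = b then ?g $$ (d + r, b) * v $ b else 0))"
      by (simp add: sum_distrib_left algebra_simps if_distrib[of "\<lambda>x. _ * x"] del: sum.lessThan_Suc cong: if_cong)
        (intro sum.cong refl, auto simp: algebra_simps)
    also have "\<dots> = (\<Sum>b<Suc r. \<Sum>a<Suc r. ?g $$ (d + r, d + a) * ?h $$ (d + a, b) * v $ b +
        u * (if d + a = b then ?g $$ (d + r, b) * v $ b else 0))"
      by (rule sum.swap)
    also have "\<dots> = (\<Sum>b<Suc r. (\<Sum>a<Suc r. ?g $$ (d + r, d + a) * ?h $$ (d + a, b)) * v $ b +
        u * (\<Sum>a<Suc r. if d + a = b then ?g $$ (d + r, b) * v $ b else 0))"
      by (simp add: sum.distrib sum_distrib_left sum_distrib_right del: sum.lessThan_Suc)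
    also have "\<dots> = (\<Sum>b<Suc r. u * (if d \<le> b then ?g $$ (d + r, b) * v $ b else 0))"
    proof (rule sum.cong[OF refl])
      fix b assume b: "b \<in> {..<Suc r}"
      have "(\<Sum>a<Suc r. if d + a = b then ?g $$ (d + r, b) * v $ b else 0) =
          (\<Sum>a<Suc r. if a = b - d then (if d \<le> b then ?g $$ (d + r, b) * v $ b else 0) else 0)"
        by (rule sum.cong) auto
      also have "\<dots> = (if d \<le> b then ?g $$ (d + r, b) * v $ b else 0)"
        using b by (subst sum.delta) auto
      finally show "(\<Sum>a<Suc r. ?g $$ (d + r, d + a) * ?h $$ (d + a, b)) * v $ b +
          u * (\<Sum>a<Suc r. if d + a = b then ?g $$ (d + r, b) * v $ b else 0) =
          u * (if d \<le> b then ?g $$ (d + r, b) * v $ b else 0)"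
        using left[of b] b by simp
    qed
    also have "\<dots> = u * (\<Sum>b<Suc r. if d \<le> b then ?g $$ (d + r, b) * v $ b else 0)"
      by (simp add: sum_distrib_left del: sum.lessThan_Suc)
    finally have row0: "(\<Sum>b<Suc r. if d \<le> b then ?g $$ (d + r, b) * v $ b else 0) = 0"
      using u by simp
    have Tuc: "T0 + u \<cdot>\<^sub>m T1 \<in> carrier_mat (Suc r) (Suc r)" using Tc by auto
    have "(T0 + u \<cdot>\<^sub>m T1) *\<^sub>v v = 0\<^sub>v (Suc r)"
    proof (rule eq_vecI)
      fix a assume "a < dim_vec (0\<^sub>v (Suc r) :: 'a vec)"
      then have a: "a < Suc r" by simp
      have "((T0 + u \<cdot>\<^sub>m T1) *\<^sub>v v) $ a = (\<Sum>b<Suc r. (T0 + u \<cdot>\<^sub>m T1) $$ (a, b) * v $ b)"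
        by (rule mat_vec_entry[OF Tuc v(1) a])
      also have "\<dots> = 0"
      proof (cases "a = 0")
        case True
        have "(\<Sum>b<Suc r. (T0 + u \<cdot>\<^sub>m T1) $$ (a, b) * v $ b) =
            (\<Sum>b<Suc r. if d \<le> b then ?g $$ (d + r, b) * v $ b else 0)"
          by (rule sum.cong) (use True in \<open>auto simp: T0_def T1_def\<close>)
        then show ?thesis using row0 by simp
      next
        case False
        have "(\<Sum>b<Suc r. (T0 + u \<cdot>\<^sub>m T1) $$ (a, b) * v $ b) =
            (\<Sum>b<Suc r. (?h $$ (d + a, b) + u * (if d + a = b then 1 else 0)) * v $ b)"
          by (rule sum.cong) (use False a in \<open>auto simp: T0_def T1_def\<close>)
        then show ?thesis using Wv[OF a] by simp
      qed
      finally show "((T0 + u \<cdot>\<^sub>m T1) *\<^sub>v v) $ a = 0\<^sub>v (Suc r) $ a" using a by simp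
    qed (use Tc in auto)
    then show ?thesis using det_0_iff_vec_prod_zero_field[OF Tuc] v by blast
  qed
  moreover have det_minor: "minor (Suc r) id id A = det A" if "A \<in> carrier_mat (Suc r) (Suc r)" for A :: "'a mat"
    unfolding minor_def by (rule arg_cong[where f = det], rule eq_matI) (use that in auto)
  ultimately have zero: "minor (Suc r) id id (T0 + u \<cdot>\<^sub>m T1) = 0" if "u \<notin> insert 0 S" for u
    using that Tc by simp
  have poly: "(minor (Suc r) id id :: 'a mat \<Rightarrow> 'a) \<in> poly_funs (Suc r)"
    by (rule minor_poly_fun) simp_all
  have "finite (insert 0 S)" using S by simp
  then have "minor (Suc r) id id (T0 + 0 \<cdot>\<^sub>m T1) = 0"
    by (rule poly_fun_zero_on_line[OF poly Tc _ zero])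
  moreover have "T0 + 0 \<cdot>\<^sub>m T1 = T0" by (rule eq_matI) (use Tc in auto)
  ultimately have "det T0 = 0" using det_minor[OF Tc(1)] by simp
  then obtain v where v: "v \<in> carrier_vec (Suc r)" "v \<noteq> 0\<^sub>v (Suc r)" "T0 *\<^sub>v v = 0\<^sub>v (Suc r)"
    using det_0_iff_vec_prod_zero_field[OF Tc(1)] by blast
  have T0v: "(\<Sum>b<Suc r. T0 $$ (a, b) * v $ b) = 0" if "a < Suc r" for a
    using mat_vec_entry[OF Tc(1) v(1) that] v(3) that by simp
  define \<kappa> where "\<kappa> b = ?g $$ (b, 0)" for b
  have \<kappa>r: "\<kappa> r \<noteq> 0" using bidiag_inv_first_col[of "Suc d" r r] d N by (simp add: \<kappa>_def bidiag_inv_mat_def)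
  define c where "c = v $ r / \<kappa> r"
  \<comment> \<open>The coefficient \<open>c\<close> makes the last entry of \<open>y\<close> zero. The rows of \<open>H\<close> after the first form a
    unitriangular system for the other entries, which therefore vanish too.\<close>
  define y where "y b = v $ b - c * \<kappa> b" for b
  have rows: "(\<Sum>b<Suc r. ?h $$ (Suc d + p, b) * y b) = 0" if "p < r" for p
  proof -
    have "(\<Sum>b<Suc r. ?h $$ (Suc d + p, b) * v $ b) = (\<Sum>b<Suc r. T0 $$ (Suc p, b) * v $ b)"
      by (rule sum.cong) (use that in \<open>auto simp: T0_def\<close>)
    also have "\<dots> = 0" using T0v[of "Suc p"] that by simp
    finally have "(\<Sum>b<Suc r. ?h $$ (Suc d + p, b) * v $ b) = 0" .
    moreover have "(\<Sum>b<Suc r. ?h $$ (Suc d + p, b) * y b) =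
       (\<Sum>b<Suc r. ?h $$ (Suc d + p, b) * v $ b) - c * (\<Sum>b<Suc r. ?h $$ (Suc d + p, b) * ?g $$ (b, 0))"
      by (simp add: y_def \<kappa>_def sum_subtractf sum_distrib_left algebra_simps del: sum.lessThan_Suc)
    ultimately show ?thesis using right[of "Suc d + p"] that N by simp
  qed
  have y0: "y b = 0" if "b \<le> r" for b
    using that
  proof (induction "r - b" arbitrary: b rule: less_induct)
    case less
    show ?case
    proof (cases "b = r")
      case True
      then show ?thesis using \<kappa>r by (simp add: y_def c_def)
    next
      case False
      then have b: "b < r" using less.prems by simp
      have "(\<Sum>b'<Suc r. ?h $$ (Suc d + b, b') * y b') = (\<Sum>b'<Suc r. if b' = b then y b else 0)"
      proof (rule sum.cong[OF refl])
        fix b' assume b': "b' \<in> {..<Suc r}"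
        show "?h $$ (Suc d + b, b') * y b' = (if b' = b then y b else 0)"
        proof (cases b' b rule: linorder_cases)
          case less
          then show ?thesis using b N by (simp add: bidiag_mat_eq_0)
        next
          case equal
          then show ?thesis using bidiag_prod_top[OF b, of "Suc d"] b N by (simp add: bidiag_mat_def add.commute)
        next
          case greater
          then show ?thesis using less.hyps[of b'] b' b by simp
        qed
      qed
      also have "\<dots> = y b" using b by (subst sum.delta) auto
      finally show ?thesis using rows[OF b] by simp
    qed
  qed
  then have v_eq: "v $ b = c * \<kappa> b" if "b \<le> r" for b using that by (simp add: y_def)
  have "0 = (\<Sum>b<Suc r. T0 $$ (0, b) * v $ b)" using T0v[of 0] by simp
  also have "\<dots> = (\<Sum>b=d..r. ?g $$ (d + r, b) * v $ b)"
    by (rule sum.mono_neutral_cong_right) (auto simp: T0_def)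
  also have "\<dots> = c * (\<Sum>b=d..r. ?g $$ (d + r, b) * ?g $$ (b, 0))"
    by (simp add: v_eq \<kappa>_def sum_distrib_left mult.left_commute)
  finally have "c = 0" using bidiag_inv_mat_square_corner[OF d N, where 'a='a] by simp
  then have "v = 0\<^sub>v (Suc r)" using v_eq v(1) by (intro eq_vecI) auto
  then show False using v(2) by simp
qed

text \<open>
  In the rows from \<open>p\<close> on, each of the columns before \<open>p + r\<close> is a combination of the first \<open>r\<close> columns. For the
  column \<open>c = c0 + r\<close> this is column \<open>c0\<close> of the equation saying that the inverse is a right inverse: the band structure
  makes \<open>c\<close> the last column that occurs in it, and the right-hand side is zero in the rows after \<open>c0\<close>.
\<close>
lemma bidiag_mat_column_dependence:
  assumes d: "0 < r" and N: "N = d + r + 1" and p: "p \<le> d" and c: "c < p + r"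
  shows "\<exists>Y. \<forall>a. p \<le> a \<longrightarrow> a < N \<longrightarrow> bidiag_mat r (Suc d) N $$ (a, c) =
    (\<Sum>q<r. bidiag_mat r (Suc d) N $$ (a, q) * (Y q :: 'a::field_char_0))"
  using c
proof (induction c rule: less_induct)
  case (less c)
  let ?h = "bidiag_mat r (Suc d) N :: 'a mat" and ?g = "bidiag_inv_mat r (Suc d) N :: 'a mat"
  show ?case
  proof (cases "c < r")
    case True
    then show ?thesis
      by (intro exI[of _ "\<lambda>q. if q = c then 1 else 0"]) (simp add: if_distrib[of "\<lambda>x. _ * x"] cong: if_cong)
  next
    case False
    define c0 where "c0 = c - r"
    have c0: "c = c0 + r" "c0 < p" using False less.prems by (auto simp: c0_def)
    have gc: "?g $$ (c, c0) \<noteq> 0"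
      using bidiag_inv_corner[of c0 "Suc d" r] c0 p N by (simp add: bidiag_inv_mat_def)
    obtain Y where Y: "\<And>z a. z < c \<Longrightarrow> p \<le> a \<Longrightarrow> a < N \<Longrightarrow> ?h $$ (a, z) = (\<Sum>q<r. ?h $$ (a, q) * Y z q)"
      using less.IH less.prems by (metis (no_types) less_trans)
    define Y' where "Y' q = - (\<Sum>z<c. Y z q * ?g $$ (z, c0)) / ?g $$ (c, c0)" for q
    have "?h $$ (a, c) = (\<Sum>q<r. ?h $$ (a, q) * Y' q)" if a: "p \<le> a" "a < N" for a
    proof -
      have "0 = (\<Sum>z<N. ?h $$ (a, z) * ?g $$ (z, c0))"
        using bidiag_mat_inverse_right[of "Suc d" r N, where 'a='a] d N a c0 p
          mat_mult_entry[of ?h N N ?g N a c0] by simp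
      also have "\<dots> = (\<Sum>z<Suc c. ?h $$ (a, z) * ?g $$ (z, c0))"
        by (rule sum.mono_neutral_right) (use c0 p N in \<open>auto simp: bidiag_inv_mat_eq_0\<close>)
      also have "\<dots> = (\<Sum>z<c. ?h $$ (a, z) * ?g $$ (z, c0)) + ?h $$ (a, c) * ?g $$ (c, c0)"
        by simp
      also have "(\<Sum>z<c. ?h $$ (a, z) * ?g $$ (z, c0)) =
          (\<Sum>z<c. \<Sum>q<r. ?h $$ (a, q) * (Y z q * ?g $$ (z, c0)))"
        using Y a by (intro sum.cong refl) (simp add: sum_distrib_right mult.assoc)
      also have "\<dots> = (\<Sum>q<r. ?h $$ (a, q) * (\<Sum>z<c. Y z q * ?g $$ (z, c0)))"
        by (subst sum.swap) (simp add: sum_distrib_left)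
      also have "\<dots> = (\<Sum>q<r. - (?h $$ (a, q) * Y' q * ?g $$ (c, c0)))"
        using gc by (intro sum.cong refl) (simp add: Y'_def)
      also have "\<dots> = - (\<Sum>q<r. ?h $$ (a, q) * Y' q) * ?g $$ (c, c0)"
        by (simp add: sum_distrib_right sum_negf)
      finally show ?thesis using gc by simp
    qed
    then show ?thesis by blast
  qed
qed

lemma sw_factors_rows:
  assumes "\<And>x y. i \<le> x \<Longrightarrow> x < n \<Longrightarrow> y < l \<Longrightarrow> A $$ (x, y) \<noteq> 0 \<Longrightarrow> x < m" and r: "m - i \<le> r"
  shows "sw_factors n r i l A"
  unfolding sw_factors_def
proof (intro exI conjI ballI allI impI)
  fix x y assume xy: "x \<in> {i..<n}" "y < l"
  have "(\<Sum>s\<in>{i..<m}. (if x = s then 1 else 0) * A $$ (s, y)) =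
      (\<Sum>s\<in>{i..<m}. if s = x then A $$ (x, y) else 0)"
    by (rule sum.cong) auto
  also have "\<dots> = A $$ (x, y)" using assms(1)[of x y] xy by (subst sum.delta) auto
  finally show "A $$ (x, y) = (\<Sum>s\<in>{i..<m}. (if x = s then 1 else 0) * A $$ (s, y))" by simp
qed (use r in auto)

lemma sw_factors_cols:
  assumes "\<And>x y. i \<le> x \<Longrightarrow> x < n \<Longrightarrow> y < l \<Longrightarrow> A $$ (x, y) \<noteq> 0 \<Longrightarrow> m \<le> y" and r: "l - m \<le> r"
  shows "sw_factors n r i l A"
  unfolding sw_factors_def
proof (intro exI conjI ballI allI impI)
  fix x y assume xy: "x \<in> {i..<n}" "y < l"
  have "(\<Sum>s\<in>{m..<l}. A $$ (x, s) * (if s = y then 1 else 0)) =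
      (\<Sum>s\<in>{m..<l}. if s = y then A $$ (x, y) else 0)"
    by (rule sum.cong) auto
  also have "\<dots> = A $$ (x, y)" using assms(1)[of x y] xy by (subst sum.delta) auto
  finally show "A $$ (x, y) = (\<Sum>s\<in>{m..<l}. A $$ (x, s) * (if s = y then 1 else 0))" by simp
qed (use r in auto)

text \<open>
  The corner at the box keeps its rank when the first row and the last column, which contain no one of the
  permutation matrix inside the corner, are removed. The parameter \<open>d\<close> is the excess of this rank over that of the
  identity, plus one; the block of the rows and columns from \<open>o'\<close> to \<open>o' + d + r\<close>, with \<open>r\<close> the rank, fits into the
  matrix. The last claim bounds all corner ranks of \<open>w\<close> from below, since removing a row or a column lowers a
  rank by at most one.
\<close>
lemma upper_diagram_box_coordinates:
  assumes w: "w permutes {1..n}" and box: "upper_diagram_box n w i l"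
  obtains d o' where "0 < d" "d \<le> sw_rank w i l" "i = o' + d" "l = o' + sw_rank w i l + 1"
    "i + sw_rank w i l < n"
    "\<And>i' l'. sw_rank w i l - (i' - Suc i) - (l - 1 - l') \<le> sw_rank w i' l'"
proof -
  let ?r = "sw_rank w i l"
  obtain m where m: "l = Suc m" using box by (cases l) (auto simp: upper_diagram_box_def)
  have il: "i < l" "l \<le> n" "w l \<le> i" "\<forall>a\<in>{1..l}. w a \<noteq> Suc i"
    using box by (auto simp: upper_diagram_box_def)
  note inj = permutes_inj[OF w]
  have r1: "sw_rank w i m = ?r" using il(3) by (simp add: m sw_rank_Suc_col)
  have r2: "sw_rank w (Suc i) l = ?r" using sw_rank_Suc_row[OF inj, of i l] il(4) by auto
  have r3: "sw_rank w (Suc i) m = ?r"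
    using r2 il(3) by (simp add: m sw_rank_Suc_col)
  have "?r \<le> m"
  proof -
    have "card {a \<in> {1..m}. i < w a} \<le> card {1..m}" by (rule card_mono) auto
    then show ?thesis using r1 by (simp add: sw_rank_def)
  qed
  have "?r \<le> n - Suc i"
  proof -
    have "card {a \<in> {1..l}. Suc i < w a} = card (w ` {a \<in> {1..l}. Suc i < w a})"
      by (rule card_image[symmetric]) (use inj in \<open>auto intro: inj_on_subset\<close>)
    also have "\<dots> \<le> card {Suc (Suc i)..n}"
    proof (rule card_mono)
      show "w ` {a \<in> {1..l}. Suc i < w a} \<subseteq> {Suc (Suc i)..n}"
      proof (rule image_subsetI)
        fix a assume "a \<in> {a \<in> {1..l}. Suc i < w a}"
        then show "w a \<in> {Suc (Suc i)..n}"
          using permutes_in_image[OF w, of a] il(2) by auto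
      qed
    qed simp
    finally show ?thesis using r2 by (simp add: sw_rank_def)
  qed
  have "l - i \<le> ?r" by (rule sw_rank_ge_diff[OF w])
  have bound: "?r - (i' - Suc i) - (l - 1 - l') \<le> sw_rank w i' l'" for i' l'
  proof -
    have "m \<le> l' + (m - l')" "i' \<le> Suc i + (i' - Suc i)" by linarith+
    then have "sw_rank w (Suc i) m \<le> sw_rank w (Suc i) (l' + (m - l'))"
      "sw_rank w (Suc i + (i' - Suc i)) l' \<le> sw_rank w i' l'"
      by (auto intro: sw_rank_mono)
    moreover have "l - 1 - l' = m - l'" using m by simp
    ultimately show ?thesis
      using sw_rank_col_diff[of w "Suc i" l' "m - l'"] r3
        sw_rank_row_diff[OF inj, of "Suc i" l' "i' - Suc i"] by linarith
  qed
  show ?thesis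
    by (rule that[of "?r - (l - i) + 1" "l - 1 - ?r"])
      (use \<open>?r \<le> m\<close> \<open>?r \<le> n - Suc i\<close> \<open>l - i \<le> ?r\<close> il m bound in auto)
qed

text \<open>The product of bidiagonal matrices, placed as a diagonal block from the row and column \<open>off\<close> on.\<close>
definition block_witness :: "nat \<Rightarrow> nat \<Rightarrow> nat \<Rightarrow> nat \<Rightarrow> 'a::field mat" where
  "block_witness n off r e = mat n n (\<lambda>(x, y). if off \<le> x \<and> off \<le> y then of_nat (bidiag_prod r e (x - off) (y - off))
     else if x = y then 1 else 0)"

text \<open>
  The bound \<open>R\<close> has to dominate only two quantities, the corner rank of the identity and the rank at the box corrected
  by the number of rows and columns removed. Except in the last case, it suffices to count the
  rows or columns of the corner that are not zero: below and to the left of the box by the band width \<open>Suc d\<close> of the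
  matrix, in the next three cases by the position of the block. If the corner contains the one at the box
  and starts inside the block, its columns before \<open>I + r\<close> are combinations of the first \<open>r\<close> columns of the block.
\<close>
lemma block_witness_sw_factors:
  assumes d: "0 < d" "d \<le> r" and fit: "off + d + r < n" and L: "L \<le> n"
    and i: "i = off + d" and l: "l = off + r + 1"
    and diag: "L - I \<le> R" and bound: "r - (I - Suc i) - (l - 1 - L) \<le> R"
  shows "sw_factors n R I L (block_witness n off r (Suc d) :: 'a::field_char_0 mat)"
proof -
  let ?H = "block_witness n off r (Suc d) :: 'a mat"
  define N where "N = d + r + 1"
  have entry: "?H $$ (x, y) = (if off \<le> x \<and> off \<le> y then of_nat (bidiag_prod r (Suc d) (x - off) (y - off))
     else if x = y then 1 else 0)" if "x < n" "y < n" for x y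
    using that by (simp add: block_witness_def)
  have nz: "x = y \<or> (off \<le> y \<and> y < x \<and> x \<le> y + Suc d \<and> x < off + N)"
    if "x < n" "y < n" "?H $$ (x, y) \<noteq> 0" for x y
  proof (cases "off \<le> x \<and> off \<le> y")
    case True
    then have bidiag_prod: "bidiag_prod r (Suc d) (x - off) (y - off) \<noteq> 0" using that entry[of x y] by auto
    show ?thesis
    proof (cases "off + N \<le> x")
      case True2: True
      then have "bidiag_prod r (Suc d) (x - off) (y - off) = (if x - off = y - off then 1 else 0)"
        by (intro bidiag_prod_row) (simp add: N_def)
      then show ?thesis using bidiag_prod True by (auto split: if_splits)
    next
      case False
      then show ?thesis using bidiag_prod_band[OF bidiag_prod] True by auto
    qed
  next
    case False
    then show ?thesis using that entry[of x y] by (auto split: if_splits)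
  qed
  consider (A) "Suc i \<le> I" "L \<le> l - 1" | (B) "Suc i \<le> I" "l \<le> L" | (D) "I \<le> i" "L \<le> l - 1"
    | (C1) "I < off" "l \<le> L" | (C2) "off \<le> I" "I \<le> i" "l \<le> L" by linarith
  then show ?thesis
  proof cases
    case A
    show ?thesis
    proof (rule sw_factors_rows[where m = "L + Suc d"])
      show "x < L + Suc d" if "I \<le> x" "x < n" "y < L" "?H $$ (x, y) \<noteq> 0" for x y
        using nz[of x y] that L by auto
    qed (use A bound i l in linarith)
  next
    case B
    show ?thesis
    proof (rule sw_factors_rows[where m = "max L (off + N)"])
      show "x < max L (off + N)" if "I \<le> x" "x < n" "y < L" "?H $$ (x, y) \<noteq> 0" for x y
        using nz[of x y] that L by auto
      have "off + N - I \<le> R" using B bound i l N_def by linarith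
      then show "max L (off + N) - I \<le> R" using diag by (simp add: max_def)
    qed
  next
    case D
    show ?thesis
    proof (rule sw_factors_cols[where m = "min I off"])
      show "min I off \<le> y" if "I \<le> x" "x < n" "y < L" "?H $$ (x, y) \<noteq> 0" for x y
        using nz[of x y] that L by auto
      have "L - off \<le> R" using D bound i l N_def by linarith
      then show "L - min I off \<le> R" using diag by (simp add: min_def)
    qed
  next
    case C1
    show ?thesis
    proof (rule sw_factors_cols[where m = I])
      show "I \<le> y" if "I \<le> x" "x < n" "y < L" "?H $$ (x, y) \<noteq> 0" for x y
        using nz[of x y] that L C1 by auto
    qed (rule diag)
  next
    case C2
    define p where "p = I - off"
    have p: "p \<le> d" "I = off + p" using C2 i by (auto simp: p_def)
    have h_entry: "?H $$ (x, off + q) = bidiag_mat r (Suc d) N $$ (x - off, q)"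
      if "off \<le> x" "x < n" "q < N" "x - off < N" for x q
      using entry[of x "off + q"] that fit by (simp add: bidiag_mat_def N_def)
    have "\<exists>Y. \<forall>a. p \<le> a \<longrightarrow> a < N \<longrightarrow> bidiag_mat r (Suc d) N $$ (a, c) =
        (\<Sum>q<r. bidiag_mat r (Suc d) N $$ (a, q) * (Y q :: 'a))" if "c < p + r" for c
      using bidiag_mat_column_dependence[of r N d p c] d p that by (simp add: N_def)
    then obtain Y :: "nat \<Rightarrow> nat \<Rightarrow> 'a" where Y: "\<And>c a. c < p + r \<Longrightarrow> p \<le> a \<Longrightarrow> a < N \<Longrightarrow>
        bidiag_mat r (Suc d) N $$ (a, c) = (\<Sum>q<r. bidiag_mat r (Suc d) N $$ (a, q) * Y c q)" by metis
    \<comment> \<open>The first \<open>r\<close> columns of the block generate all columns before \<open>I + r\<close>; the later ones are kept.\<close>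
    let ?S = "{off..<off + r} \<union> {I + r..<L}"
    define Z where "Z s y = (if y < off then 0 else if y < I + r
        then (if s < off + r then Y (y - off) (s - off) else 0) else if s = y then 1 else 0)" for s y
    have "?H $$ (x, y) = (\<Sum>s\<in>?S. ?H $$ (x, s) * Z s y)" if x: "I \<le> x" "x < n" and y: "y < L" for x y
    proof -
      consider "y < off" | "off \<le> y" "y < I + r" | "I + r \<le> y" by linarith
      then show ?thesis
      proof cases
        case 1
        then have "?H $$ (x, y) = 0" using nz[of x y] x y L C2 by auto
        then show ?thesis using 1 by (simp add: Z_def)
      next
        case 2
        have "(\<Sum>s\<in>?S. ?H $$ (x, s) * Z s y) = (\<Sum>s\<in>{off..<off + r}. ?H $$ (x, s) * Y (y - off) (s - off))"
          by (rule sum.mono_neutral_cong_right) (use 2 C2 in \<open>auto simp: Z_def\<close>)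
        also have "\<dots> = (\<Sum>q<r. ?H $$ (x, off + q) * Y (y - off) q)"
          by (rule sum.reindex_bij_witness[of _ "\<lambda>q. off + q" "\<lambda>s. s - off"]) auto
        also have "\<dots> = ?H $$ (x, y)"
        proof (cases "x < off + N")
          case True
          then have "(\<Sum>q<r. ?H $$ (x, off + q) * Y (y - off) q) =
              (\<Sum>q<r. bidiag_mat r (Suc d) N $$ (x - off, q) * Y (y - off) q)"
            using x C2 by (intro sum.cong refl) (auto simp: h_entry N_def)
          also have "\<dots> = bidiag_mat r (Suc d) N $$ (x - off, y - off)"
            using Y[of "y - off" "x - off"] 2 x C2 True p by auto
          also have "\<dots> = ?H $$ (x, y)"
            using h_entry[of x "y - off"] x C2 True 2 p by (simp add: N_def)
          finally show ?thesis .
        next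
          case False
          have "y < x" using False 2 p by (simp add: N_def)
          then have "?H $$ (x, y) = 0" using nz[of x y] x False 2 by auto
          moreover have "?H $$ (x, off + q) = 0" if "q < r" for q
            using nz[of x "off + q"] x False that fit by (auto simp: N_def)
          ultimately show ?thesis by simp
        qed
        finally show ?thesis by simp
      next
        case 3
        have "(\<Sum>s\<in>?S. ?H $$ (x, s) * Z s y) = (\<Sum>s\<in>?S. if s = y then ?H $$ (x, y) else 0)"
          by (rule sum.cong) (use 3 C2 in \<open>auto simp: Z_def\<close>)
        also have "\<dots> = ?H $$ (x, y)" using 3 y by (subst sum.delta) auto
        finally show ?thesis by simp
      qed
    qed
    moreover have "card ?S \<le> R"
    proof -
      have "card ?S \<le> r + (L - (I + r))"
        by (rule order_trans[OF card_Un_le]) simp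
      moreover have "r \<le> R" using bound C2 by simp
      ultimately show ?thesis using diag by linarith
    qed
    ultimately show ?thesis
      unfolding sw_factors_def
      by (intro exI[of _ ?S] exI[of _ "\<lambda>x s. ?H $$ (x, s)"] exI[of _ Z]) auto
  qed
qed

section \<open>Homogeneous elements\<close>

text \<open>
  For \<open>1 + x\<close> the block matrix above and \<open>t = 1 / (1 + u)\<close>, the corner of \<open>1 + t x\<close> at the box is \<open>t (H + u E)\<close>.
  If \<open>Y_set n w\<close> were a cone, it would be singular for all \<open>u \<noteq> - 1\<close>.
\<close>
lemma no_upper_diagram_box_if_cone:
  assumes w: "w permutes {1..n}" and cone: "is_cone (Y_set n w :: 'a::field_char_0 mat set)"
  shows "\<not> upper_diagram_box n w i l"
proof
  assume box: "upper_diagram_box n w i l"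
  let ?r = "sw_rank w i l"
  obtain d off where d: "0 < d" "d \<le> ?r" and i: "i = off + d" and l: "l = off + ?r + 1"
    and fit: "i + ?r < n"
    and bound: "\<And>i' l'. ?r - (i' - Suc i) - (l - 1 - l') \<le> sw_rank w i' l'"
    using upper_diagram_box_coordinates[OF w box] by blast
  have ln: "l \<le> n" using box by (simp add: upper_diagram_box_def)
  define r where "r = ?r"
  let ?H = "block_witness n off r (Suc d) :: 'a mat"
  define x where "x = ?H - 1\<^sub>m n"
  have Hc: "?H \<in> carrier_mat n n" by (simp add: block_witness_def)
  have x: "x \<in> strictly_lower n"
  proof -
    have "bidiag_prod r (Suc d) a b = (if a = b then 1 else 0)" if "a \<le> b" for a b
      using that bidiag_prod_band[of r "Suc d" a b] bidiag_prod_diag[of r "Suc d" a] by (cases "a = b") fastforce+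
    then show ?thesis by (auto simp: x_def strictly_lower_def block_witness_def)
  qed
  have one_x: "1\<^sub>m n + x = ?H" by (rule eq_matI) (use Hc in \<open>auto simp: x_def\<close>)
  have "sw_factors n (sw_rank w I L) I L ?H" if "L \<le> n" for I L
    using d i l fit bound that sw_rank_ge_diff[OF w]
    by (intro block_witness_sw_factors[where i = i and l = l]) (auto simp: r_def)
  then have xY: "x \<in> Y_set n w"
    using schubert_variety_iff_sw_factors[OF one_plus_strictly_lower_GL[OF x] w] x
    by (simp add: Y_set_iff one_x)
  have scaled: "mod_Borel n (1\<^sub>m n + t \<cdot>\<^sub>m x) \<in> schubert_variety n w" for t
  proof -
    have "t \<cdot>\<^sub>m x \<in> Y_set n w" using cone xY unfolding is_cone_def by blast
    then show ?thesis by (simp add: Y_set_iff)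
  qed
  define N where "N = d + r + 1"
  let ?W = "\<lambda>u. mat (Suc r) (Suc r) (\<lambda>(a, b). bidiag_mat r (Suc d) N $$ (d + a, b) + u * (if d + a = b then 1 else 0)) :: 'a mat"
  have "det (?W u) = 0" if u: "u \<notin> {-1}" for u
  proof -
    have u1: "1 + u \<noteq> 0" using u by (metis add.commute add_eq_0_iff singletonI)
    define t where "t = 1 / (1 + u)"
    have t0: "t \<noteq> 0" "1 - t = t * u" using u1 by (auto simp: t_def field_simps)
    let ?g = "1\<^sub>m n + t \<cdot>\<^sub>m x"
    note tx = smult_strictly_lower[OF x, of t]
    have gc: "?g \<in> carrier_mat n n" using strictly_lower_carrier[OF tx] by simp
    have "minor (Suc r) (\<lambda>a. i + a) (\<lambda>b. off + b) (1\<^sub>m n * ?g * 1\<^sub>m n) = 0"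
      by (rule schubert_variety_minor_eq_0[OF one_plus_strictly_lower_GL[OF tx] scaled ln, where i = i])
        (use fit l Borel_one w in \<open>auto simp: r_def\<close>)
    moreover have "1\<^sub>m n * ?g * 1\<^sub>m n = ?g"
      by (subst left_mult_one_mat[OF gc], rule right_mult_one_mat[OF gc])
    ultimately have "minor (Suc r) (\<lambda>a. i + a) (\<lambda>b. off + b) ?g = 0" by simp
    moreover have "mat (Suc r) (Suc r) (\<lambda>(a, b). ?g $$ (i + a, off + b)) = t \<cdot>\<^sub>m ?W u"
    proof (rule eq_matI)
      fix a b assume "a < dim_row (t \<cdot>\<^sub>m ?W u)" "b < dim_col (t \<cdot>\<^sub>m ?W u)"
      then have ab: "a < Suc r" "b < Suc r" by auto
      have bnd: "off + (d + a) < n" "off + b < n" using ab fit i by (auto simp: r_def)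
      have "?H $$ (i + a, off + b) = bidiag_mat r (Suc d) N $$ (d + a, b)"
        using ab bnd i by (simp add: block_witness_def bidiag_mat_def N_def)
      then have "?g $$ (i + a, off + b) = (1 - t) * (if d + a = b then 1 else 0) + t * bidiag_mat r (Suc d) N $$ (d + a, b)"
        using bnd i Hc by (simp add: x_def algebra_simps)
      then show "mat (Suc r) (Suc r) (\<lambda>(a, b). ?g $$ (i + a, off + b)) $$ (a, b) = (t \<cdot>\<^sub>m ?W u) $$ (a, b)"
        using ab by (simp add: t0 algebra_simps)
    qed auto
    ultimately have "t ^ Suc r * det (?W u) = 0"
      by (simp add: minor_def det_smult)
    then show ?thesis using t0 by simp
  qed
  then show False
    using window_nonsingular[of d r N "{-1}"] d by (auto simp: N_def r_def)
qed

theorem theorem1p2: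
  fixes n :: nat and w :: "nat \<Rightarrow> nat"
  assumes "n \<ge> 1" and "w permutes {1..n}"
  shows "homogeneous TYPE('a::field_char_0) n w \<longleftrightarrow> (\<exists>D. basic n D \<and> w = w_perm n D)"
  using cone_if_no_upper_diagram_box[OF assms(2), where 'a = 'a]
    no_upper_diagram_box_if_cone[OF assms(2), where 'a = 'a]
    w_perm_eq_iff_no_upper_diagram_box[OF assms(2)]
  unfolding homogeneous_def by blast

end
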